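(* Fix any $m\ge3$, $\sigma\in\mathcal{S}_m$, $q>0$, $n\ge 2m-1$, and let $N_n(\sigma,q)$ denote the number of occurrences of $\sigma$ in a random permutation of length $n$ drawn from the Mallows($q$) distribution. For $1\le s\le m-1$ define $$\mu(\sigma,q):=\frac{q^{\operatorname{inv}(\sigma)}}{[m]_q!},\qquad a_n(\sigma,q):=(n-m+1)\mu(\sigma,q),\qquad T(s,\sigma,q):=\sum_{\tau\in\mathrm{Ov}_s(\sigma)}\frac{q^{\operatorname{inv}(\tau)}}{[2m-s]_q!},$$ $$b_n(\sigma,q)^2:=(n-m+1)\mu(\sigma,q)(1-\mu(\sigma,q))+2\sum_{s=1}^{m-1}(n-2m+1+s)\left(T(s,\sigma,q)-\mu(\sigma,q)^2\right),$$ $$\theta_n(\sigma,q):=\frac{\mu(\sigma,q)(1-\mu(\sigma,q))^3+(1-\mu(\sigma,q))\mu(\sigma,q)^3}{b_n(\sigma,q)^3}.$$ Then $$\sup_k\left|\mathbb{P}(N_n(\sigma,q)\le k)-\mathbb{P}\left(Z\le\frac{k-a_n(\sigma,q)}{b_n(\sigma,q)}\right)\right|\le 75\,(10(m-1)+1)^2\,(n-m+1)\,\theta_n(\sigma,q),$$ where $Z$ is a standard Gaussian random variable (mean $0$, variance $1$).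
   Context: For $q>0$, the Mallows($q$) distribution on $\mathcal{S}_n$ (permutations of $[n]$) gives $\pi$ probability $q^{\operatorname{inv}(\pi)}/[n]_q!$, where $\operatorname{inv}(\pi)$ is the number of pairs $i<j$ with $\pi_i>\pi_j$, $[n]_q=1+q+\dots+q^{n-1}$, $[n]_q!=[1]_q\cdots[n]_q$. For distinct integers $w=w_1\dots w_k$, $\operatorname{st}(w)$ is the permutation of $[k]$ order-isomorphic to $w$. The number of occurrences of $\sigma\in\mathcal{S}_m$ in $\pi\in\mathcal{S}_n$ is the number of $j\in[n-m+1]$ with $\operatorname{st}(\pi_j\pi_{j+1}\dots\pi_{j+m-1})=\sigma$. For $1\le s\le m-1$, the overlap set $\mathrm{Ov}_s(\sigma)$ is the set of $\tau\in\mathcal{S}_{2m-s}$ with $\operatorname{st}(\tau_1\cdots\tau_m)=\operatorname{st}(\tau_{m-s+1}\cdots\tau_{2m-s})=\sigma$. *)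

theory Defs
  imports "HOL-Probability.Probability" "HOL-Combinatorics.Multiset_Permutations"
begin

text \<open>
  Permutations are lists in one-line notation, with entries in \<open>{1..n}\<close>. Entries are 1-based,
  but list positions are 0-based: the letter \<open>\<pi>\<^sub>i\<close> is \<open>\<pi> ! (i - 1)\<close>.
\<close>

abbreviation Sym :: "nat \<Rightarrow> nat list set" where
  "Sym n \<equiv> permutations_of_set {1..n}"

definition inversions :: "nat list \<Rightarrow> nat" where
  "inversions w = card {(i, j). i < j \<and> j < length w \<and> w ! i > w ! j}"

definition qint :: "real \<Rightarrow> nat \<Rightarrow> real" where
  "qint q n = (\<Sum>i<n. q ^ i)"

definition qfact :: "real \<Rightarrow> nat \<Rightarrow> real" where
  "qfact q n = (\<Prod>k=1..n. qint q k)"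

text \<open>
  For \<open>q > 0\<close> the weights are nonnegative and sum to 1, so that \<^const>\<open>embed_pmf\<close> yields
  the distribution with exactly these weights; see \<open>pmf_mallows\<close> below.
\<close>

definition mallows :: "nat \<Rightarrow> real \<Rightarrow> nat list pmf" where
  "mallows n q =
     embed_pmf (\<lambda>\<pi>. if \<pi> \<in> Sym n then q ^ inversions \<pi> / qfact q n else 0)"

text \<open>Standardization replaces every entry of a word of distinct numbers by its rank.\<close>

definition st :: "nat list \<Rightarrow> nat list" where
  "st w = map (\<lambda>x. card {y \<in> set w. y \<le> x}) w"

text \<open>The factor of \<open>w\<close> with \<open>m\<close> letters that starts at the 0-based position \<open>j\<close>.\<close>

definition factor :: "nat \<Rightarrow> nat \<Rightarrow> nat list \<Rightarrow> nat list" where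
  "factor j m w = take m (drop j w)"

definition occurrences :: "nat list \<Rightarrow> nat list \<Rightarrow> nat" where
  "occurrences \<sigma> \<pi> =
     card {j. j + length \<sigma> \<le> length \<pi> \<and> st (factor j (length \<sigma>) \<pi>) = \<sigma>}"

definition Ov :: "nat \<Rightarrow> nat list \<Rightarrow> nat list set" where
  "Ov s \<sigma> = (let m = length \<sigma> in
     {\<tau> \<in> Sym (2 * m - s). st (factor 0 m \<tau>) = \<sigma> \<and> st (factor (m - s) m \<tau>) = \<sigma>})"

definition mu :: "nat list \<Rightarrow> real \<Rightarrow> real" where
  "mu \<sigma> q = q ^ inversions \<sigma> / qfact q (length \<sigma>)"

definition a_mean :: "nat \<Rightarrow> nat list \<Rightarrow> real \<Rightarrow> real" where
  "a_mean n \<sigma> q = (real n - real (length \<sigma>) + 1) * mu \<sigma> q"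

definition T :: "nat \<Rightarrow> nat list \<Rightarrow> real \<Rightarrow> real" where
  "T s \<sigma> q = (\<Sum>\<tau>\<in>Ov s \<sigma>. q ^ inversions \<tau> / qfact q (2 * length \<sigma> - s))"

definition b_sq :: "nat \<Rightarrow> nat list \<Rightarrow> real \<Rightarrow> real" where
  "b_sq n \<sigma> q = (let m = length \<sigma> in
     (real n - real m + 1) * mu \<sigma> q * (1 - mu \<sigma> q)
     + 2 * (\<Sum>s=1..m-1. (real n - 2 * real m + 1 + real s) * (T s \<sigma> q - (mu \<sigma> q)\<^sup>2)))"

definition b_dev :: "nat \<Rightarrow> nat list \<Rightarrow> real \<Rightarrow> real" where
  "b_dev n \<sigma> q = sqrt (b_sq n \<sigma> q)"

definition theta :: "nat \<Rightarrow> nat list \<Rightarrow> real \<Rightarrow> real" where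
  "theta n \<sigma> q =
     (mu \<sigma> q * (1 - mu \<sigma> q) ^ 3 + (1 - mu \<sigma> q) * mu \<sigma> q ^ 3) / b_dev n \<sigma> q ^ 3"

lemma card_rank_less_bij:
  fixes A :: "nat set"
  assumes "finite A"
  shows "bij_betw (\<lambda>x. card {y \<in> A. y < x}) A {..<card A}"
proof -
  let ?r = "\<lambda>x. card {y \<in> A. y < x}"
  have mono: "?r x < ?r y" if "x \<in> A" "y \<in> A" "x < y" for x y
  proof (rule psubset_card_mono)
    have "x \<in> {z \<in> A. z < y}" "x \<notin> {z \<in> A. z < x}"
      using that by simp_all
    moreover have "{z \<in> A. z < x} \<subseteq> {z \<in> A. z < y}"
      using that by (simp add: Collect_mono_iff)
    ultimately show "{z \<in> A. z < x} \<subset> {z \<in> A. z < y}"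
      by blast
  qed (simp add: assms)
  have inj: "inj_on ?r A"
  proof (rule inj_onI)
    fix x y assume "x \<in> A" "y \<in> A" "?r x = ?r y"
    then show "x = y"
      using mono[of x y] mono[of y x] by (cases x y rule: linorder_cases) simp_all
  qed
  have "?r x < card A" if "x \<in> A" for x
    using that assms by (intro psubset_card_mono) blast+
  then have "?r ` A \<subseteq> {..<card A}"
    by auto
  then have "?r ` A = {..<card A}"
    using inj by (intro card_subset_eq) (auto simp: card_image)
  then show ?thesis
    using inj by (simp add: bij_betw_def)
qed

lemma card_rank_le_bij:
  fixes A :: "nat set"
  assumes "finite A"
  shows "bij_betw (\<lambda>x. card {y \<in> A. y \<le> x}) A {1..card A}"
proof -
  have eq: "card {y \<in> A. y \<le> x} = Suc (card {y \<in> A. y < x})" if "x \<in> A" for x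
  proof -
    have "{y \<in> A. y \<le> x} = insert x {y \<in> A. y < x}"
      using that by auto
    then show ?thesis
      using assms by simp
  qed
  have "bij_betw (Suc \<circ> (\<lambda>x. card {y \<in> A. y < x})) A {1..card A}"
    by (rule bij_betw_trans[OF card_rank_less_bij[OF assms]])
       (simp add: bij_betw_def image_Suc_lessThan)
  then show ?thesis
    unfolding comp_def by (rule iffD1[OF bij_betw_cong, rotated]) (rule eq[symmetric])
qed

lemma st_in_Sym:
  assumes "distinct w"
  shows "st w \<in> Sym (length w)"
proof (rule permutations_of_setI)
  let ?r = "\<lambda>x. card {y \<in> set w. y \<le> x}"
  have bij: "bij_betw ?r (set w) {1..card (set w)}"
    by (rule card_rank_le_bij) simp
  show "set (st w) = {1..length w}"
    unfolding st_def set_map bij_betw_imp_surj_on[OF bij] distinct_card[OF assms] ..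
  show "distinct (st w)"
    unfolding st_def distinct_map using assms bij_betw_imp_inj_on[OF bij] by blast
qed

lemma st_order_iso:
  assumes "i < length w" "j < length w"
  shows "st w ! i < st w ! j \<longleftrightarrow> w ! i < w ! j"
proof -
  let ?S = "\<lambda>x. {y \<in> set w. y \<le> x}"
  have nth: "st w ! i = card (?S (w ! i))" "st w ! j = card (?S (w ! j))"
    using assms by (simp_all add: st_def)
  show ?thesis
  proof (cases "w ! i < w ! j")
    case True
    have "w ! j \<in> ?S (w ! j)" "w ! j \<notin> ?S (w ! i)"
      using True nth_mem[OF assms(2)] by simp_all
    moreover have "?S (w ! i) \<subseteq> ?S (w ! j)"
      using True by (simp add: Collect_mono_iff)
    ultimately have "?S (w ! i) \<subset> ?S (w ! j)"
      by blast
    then have "card (?S (w ! i)) < card (?S (w ! j))"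
      by (rule psubset_card_mono[rotated]) simp
    with True nth show ?thesis
      by simp
  next
    case False
    then have "?S (w ! j) \<subseteq> ?S (w ! i)"
      by (simp add: Collect_mono_iff)
    then have "card (?S (w ! j)) \<le> card (?S (w ! i))"
      by (rule card_mono[rotated]) simp
    with False nth show ?thesis
      by simp
  qed
qed

lemma inversions_Nil [simp]: "inversions [] = 0"
  by (simp add: inversions_def)

lemma inversions_Cons:
  assumes "distinct (x # xs)"
  shows "inversions (x # xs) = card {y \<in> set xs. y < x} + inversions xs"
proof -
  let ?J = "{j. j < length xs \<and> xs ! j < x}"
  let ?I = "{(i, j). i < j \<and> j < length xs \<and> xs ! i > xs ! j}"
  have fin: "finite ?I"
    by (rule finite_subset[of _ "{..<length xs} \<times> {..<length xs}"]) auto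
  have "{(i, j). i < j \<and> j < length (x # xs) \<and> (x # xs) ! i > (x # xs) ! j}
        = (\<lambda>j. (0, Suc j)) ` ?J \<union> map_prod Suc Suc ` ?I" (is "?L = ?R")
  proof (rule set_eqI)
    fix p :: "nat \<times> nat"
    obtain i j where "p = (i, j)"
      by fastforce
    then show "p \<in> ?L \<longleftrightarrow> p \<in> ?R"
      by (cases i; cases j) (simp_all add: image_iff split_beta)
  qed
  then have "inversions (x # xs) = card ((\<lambda>j. (0::nat, Suc j)) ` ?J \<union> map_prod Suc Suc ` ?I)"
    by (simp add: inversions_def)
  also have "\<dots> = card ((\<lambda>j. (0::nat, Suc j)) ` ?J) + card (map_prod Suc Suc ` ?I)"
    using fin by (intro card_Un_disjoint) auto
  also have "card ((\<lambda>j. (0::nat, Suc j)) ` ?J) = card ?J"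
    by (intro card_image) (auto simp: inj_on_def)
  also have "card (map_prod Suc Suc ` ?I) = inversions xs"
    unfolding inversions_def by (intro card_image inj_onI) (simp add: prod_eq_iff)
  also have "card ?J = card ((!) xs ` ?J)"
    using assms by (intro card_image[symmetric]) (auto simp: inj_on_def nth_eq_iff_index_eq)
  also have "(!) xs ` ?J = {y \<in> set xs. y < x}"
    by (auto simp: in_set_conv_nth)
  finally show ?thesis .
qed

lemma sum_inversions:
  assumes "finite A"
  shows "(\<Sum>w\<in>permutations_of_set A. q ^ inversions w) = qfact q (card A)"
  using assms
proof (induction "card A" arbitrary: A)
  case 0
  then show ?case
    by (simp add: qfact_def)
next
  case (Suc n)
  then have ne: "A \<noteq> {}"
    by auto
  have "(\<Sum>w\<in>permutations_of_set A. q ^ inversions w)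
        = (\<Sum>x\<in>A. \<Sum>w\<in>(#) x ` permutations_of_set (A - {x}). q ^ inversions w)"
    unfolding permutations_of_set_nonempty[OF ne]
    using Suc.prems by (intro sum.UNION_disjoint) auto
  also have "\<dots> = (\<Sum>x\<in>A. q ^ card {y \<in> A. y < x} * qfact q n)"
  proof (rule sum.cong[OF refl])
    fix x assume x: "x \<in> A"
    have "(\<Sum>w\<in>(#) x ` permutations_of_set (A - {x}). q ^ inversions w)
          = (\<Sum>w\<in>permutations_of_set (A - {x}). q ^ inversions (x # w))"
      by (subst sum.reindex) auto
    also have "\<dots> = (\<Sum>w\<in>permutations_of_set (A - {x}).
                      q ^ card {y \<in> A. y < x} * q ^ inversions w)"
    proof (rule sum.cong[OF refl])
      fix w assume "w \<in> permutations_of_set (A - {x})"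
      then have w: "set w = A - {x}" "distinct w"
        by (auto dest: permutations_of_setD)
      have "{y \<in> set w. y < x} = {y \<in> A. y < x}"
        using w by auto
      then show "q ^ inversions (x # w) = q ^ card {y \<in> A. y < x} * q ^ inversions w"
        using w by (simp add: inversions_Cons power_add)
    qed
    also have "\<dots> = q ^ card {y \<in> A. y < x} * qfact q n"
    proof -
      have n: "card (A - {x}) = n"
        using Suc.hyps(2) Suc.prems x by simp
      then have "(\<Sum>w\<in>permutations_of_set (A - {x}). q ^ inversions w) = qfact q n"
        using Suc.hyps(1)[of "A - {x}"] Suc.prems by simp
      then show ?thesis
        by (simp add: sum_distrib_left[symmetric])
    qed
    finally show "(\<Sum>w\<in>(#) x ` permutations_of_set (A - {x}). q ^ inversions w)
                  = q ^ card {y \<in> A. y < x} * qfact q n" .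
  qed
  also have "\<dots> = (\<Sum>x\<in>A. q ^ card {y \<in> A. y < x}) * qfact q n"
    by (simp add: sum_distrib_right)
  also have "(\<Sum>x\<in>A. q ^ card {y \<in> A. y < x}) = qint q (card A)"
    unfolding qint_def
    by (rule sum.reindex_bij_betw[OF card_rank_less_bij[OF Suc.prems]])
  also have "qint q (card A) * qfact q n = qfact q (card A)"
    by (simp add: qfact_def Suc.hyps(2)[symmetric])
  finally show ?case .
qed

lemma qfact_pos:
  assumes "q > 0"
  shows "qfact q n > 0"
  unfolding qfact_def qint_def using assms
  by (intro prod_pos ballI sum_pos) (auto simp: lessThan_empty_iff)

lemma pmf_mallows:
  assumes "q > 0"
  shows "pmf (mallows n q) \<pi> = (if \<pi> \<in> Sym n then q ^ inversions \<pi> / qfact q n else 0)"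
proof -
  let ?f = "\<lambda>\<pi>. if \<pi> \<in> Sym n then q ^ inversions \<pi> / qfact q n else 0"
  have nonneg: "?f w \<ge> 0" for w
    using assms qfact_pos[OF assms, of n] by simp
  have "(\<integral>\<^sup>+w. ennreal (?f w) \<partial>count_space UNIV) = (\<Sum>w\<in>Sym n. ennreal (?f w))"
    by (rule nn_integral_count_space') auto
  also have "\<dots> = ennreal (\<Sum>w\<in>Sym n. ?f w)"
    by (rule sum_ennreal) (rule nonneg)
  also have "(\<Sum>w\<in>Sym n. ?f w) = (\<Sum>w\<in>Sym n. q ^ inversions w) / qfact q n"
    by (simp add: sum_divide_distrib)
  also have "\<dots> = 1"
    using sum_inversions[of "{1..n}" q] qfact_pos[OF assms, of n] by simp
  finally have "(\<integral>\<^sup>+w. ennreal (?f w) \<partial>count_space UNIV) = 1"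
    by simp
  then show ?thesis
    unfolding mallows_def using nonneg by (subst pmf_embed_pmf) auto
qed

end

theory Submission
  imports Defs
begin

text \<open>
  Cutting a Mallows permutation at a position yields two words whose standardizations are
  independent Mallows permutations, since the inversions across the cut depend only on the set of
  letters to the left of it. Hence the indicators of an occurrence at the successive positions are
  \<open>(m - 1)\<close>-dependent, and \<open>b_sq\<close> is the variance of their sum.

  For a normalized sum \<open>W\<close> of centred \<open>d\<close>-dependent variables bounded by \<open>A\<close>, with second moments
  summing to \<open>V\<close>, let \<open>rate = (2d + 1)\<^sup>2 V A\<close>, which may be assumed to be small. Stein's method
  applied to an indicator smoothed over an interval of length \<open>4 rate\<close> bounds the distance \<open>\<delta>\<close> to
  the normal distribution by \<open>14 rate + \<delta> / 2\<close>: the probability that \<open>W\<close> falls into a short interval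
  is itself estimated by \<open>2 \<delta>\<close> plus half the length of the interval. This gives \<open>\<delta> \<le> 28 rate\<close>, which
  suffices because the third absolute moment of a centred indicator is at least half its second
  moment.
\<close>

section \<open>Stein's equation for the normal distribution\<close>

lemma set_integral_atMost_split:
  fixes g :: "real \<Rightarrow> real"
  assumes "integrable lborel g" "a \<le> x"
  shows "(LINT t:{..x}|lborel. g t) = (LINT t:{..a}|lborel. g t) + (LINT t:{a..x}|lborel. g t)"
proof -
  have integrable_on: "set_integrable lborel S g" if "S \<in> sets borel" for S
    using assms(1) that unfolding set_integrable_def by (intro integrable_mult_indicator) auto
  have "AE t in lborel. \<not> (t \<in> {..a} \<and> t \<in> {a..x})"
    using AE_lborel_singleton[of a] by eventually_elim auto
  then have "(LINT t:{..a} \<union> {a..x}|lborel. g t)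
      = (LINT t:{..a}|lborel. g t) + (LINT t:{a..x}|lborel. g t)"
    by (intro set_integral_Un_AE integrable_on) auto
  moreover have "{..a} \<union> {a..x} = {..x}"
    using assms(2) by auto
  ultimately show ?thesis
    by simp
qed

lemma tendsto_set_integral_atMost_at_bot:
  fixes g :: "real \<Rightarrow> real"
  assumes "integrable lborel g"
  shows "((\<lambda>x. LINT t:{..x}|lborel. g t) \<longlongrightarrow> 0) at_bot"
proof -
  let ?G = "\<lambda>x. LINT t:{..x}|lborel. g t"
  have "set_integrable lborel {..0} g"
    using assms unfolding set_integrable_def by (intro integrable_mult_indicator) auto
  then have "((\<lambda>x. ?G 0 - (LINT t:{x..0}|lborel. g t)) \<longlongrightarrow> ?G 0 - ?G 0) at_bot"
    by (intro tendsto_diff tendsto_const tendsto_set_lebesgue_integral_at_bot) auto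
  moreover have "\<forall>\<^sub>F x in at_bot. ?G 0 - (LINT t:{x..0}|lborel. g t) = ?G x"
    using eventually_le_at_bot[of 0]
    by eventually_elim (simp add: set_integral_atMost_split[OF assms, of _ 0])
  ultimately show ?thesis
    using tendsto_cong by fastforce
qed

lemma has_real_derivative_set_integral_atMost:
  fixes g :: "real \<Rightarrow> real"
  assumes "integrable lborel g" "continuous_on UNIV g"
  shows "((\<lambda>x. LINT t:{..x}|lborel. g t) has_real_derivative g x) (at x)"
proof -
  let ?G = "\<lambda>y. LINT t:{..y}|lborel. g t"
  have "((\<lambda>y. integral {x - 1..y} g) has_real_derivative g x) (at x within {x - 1..x + 1})"
    by (rule integral_has_real_derivative) (auto intro: continuous_on_subset[OF assms(2)])
  then have "((\<lambda>y. integral {x - 1..y} g) has_real_derivative g x) (at x)"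
    by (simp add: at_within_Icc_at)
  then have "((\<lambda>y. ?G (x - 1) + integral {x - 1..y} g) has_real_derivative g x) (at x)"
    by (auto intro!: derivative_eq_intros)
  moreover have "?G y = ?G (x - 1) + integral {x - 1..y} g" if "y \<in> {x - 1<..}" for y
  proof -
    have "set_integrable lborel {x - 1..y} g"
      using assms(1) unfolding set_integrable_def by (intro integrable_mult_indicator) auto
    then show ?thesis
      using set_integral_atMost_split[OF assms(1), of "x - 1" y] that
      by (simp add: set_borel_integral_eq_integral(2))
  qed
  then have "\<forall>\<^sub>F y in nhds x. ?G y = ?G (x - 1) + integral {x - 1..y} g"
    using eventually_nhds_in_open[of "{x - 1<..}" x] by (auto elim!: eventually_mono)
  ultimately show ?thesis
    by (subst DERIV_cong_ev[OF refl _ refl])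
qed

lemma has_real_derivative_std_normal_density:
  "(std_normal_density has_real_derivative (- x * std_normal_density x)) (at x)"
  unfolding std_normal_density_def [abs_def]
  by (auto intro!: derivative_eq_intros simp: field_simps)

lemma std_normal_density_pos: "std_normal_density x > 0"
  by (rule normal_density_pos) simp

lemma std_normal_density_minus: "std_normal_density (- x) = std_normal_density x"
  by (simp add: std_normal_density_def)

lemma std_normal_density_le_half: "std_normal_density x \<le> 1 / 2"
proof -
  have "2 \<le> sqrt (2 * pi)"
    using pi_gt3 by (intro real_le_rsqrt) simp
  then have "1 / sqrt (2 * pi) \<le> 1 / 2"
    by (intro divide_left_mono) auto
  then have "(1 / sqrt (2 * pi)) * exp (- x\<^sup>2 / 2) \<le> (1 / 2) * 1"
    by (intro mult_mono) auto
  then show ?thesis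
    by (simp add: std_normal_density_def)
qed

lemma cdf_std_normal_diff_le:
  assumes "x \<le> y"
  shows "cdf std_normal_distribution y - cdf std_normal_distribution x \<le> (y - x) / 2"
proof (cases "x = y")
  case False
  with assms have less: "x < y" by simp
  interpret real_distribution std_normal_distribution
    by (rule real_dist_normal_dist)
  have "cdf std_normal_distribution y - cdf std_normal_distribution x
      = (LINT t|std_normal_distribution. indicator {x<..y} t)"
    using cdf_diff_eq[OF less] by simp
  also have "\<dots> = (LINT t|lborel. std_normal_density t * indicator {x<..y} t)"
    by (subst integral_density) auto
  also have "\<dots> \<le> (LINT t|lborel. (1 / 2) * indicator {x<..y} t)"
  proof (rule integral_mono)
    show "integrable lborel (\<lambda>t. std_normal_density t * indicator {x<..y} t)"
      by (intro integrable_real_mult_indicator) auto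
    show "integrable lborel (\<lambda>t. (1 / 2) * indicator {x<..y} t :: real)"
      using less by simp
  qed (use std_normal_density_le_half in \<open>auto simp: indicator_def\<close>)
  also have "\<dots> = (y - x) / 2"
    using less by simp
  finally show ?thesis .
qed simp

lemma tendsto_std_normal_density_over_id: "((\<lambda>x. std_normal_density x / x) \<longlongrightarrow> 0) at_top"
proof (rule tendsto_sandwich[where f = "\<lambda>_. 0" and h = "\<lambda>x. (1 / 2) / x"])
  show "\<forall>\<^sub>F x in at_top. 0 \<le> std_normal_density x / x"
    using eventually_gt_at_top[of 0] by eventually_elim simp
  show "\<forall>\<^sub>F x in at_top. std_normal_density x / x \<le> (1 / 2) / x"
    using eventually_gt_at_top[of 0]
    by eventually_elim (intro divide_right_mono std_normal_density_le_half, simp)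
  show "((\<lambda>x::real. (1 / 2) / x) \<longlongrightarrow> 0) at_top"
    by (intro tendsto_divide_0[OF tendsto_const] filterlim_at_top_imp_at_infinity filterlim_ident)
qed simp

lemma gaussian_tail_le:
  assumes deriv: "\<And>y. (G has_real_derivative G' y) (at y)"
    and lower: "\<And>y. - (C * std_normal_density y) \<le> G' y"
    and "0 \<le> C" and lim: "(G \<longlongrightarrow> 0) at_top" and "x > 0"
  shows "G x \<le> C * (std_normal_density x / x)"
proof -
  define u where "u y = C * (std_normal_density y / y) - G y" for y
  have deriv_u: "(u has_real_derivative - C * std_normal_density y * (1 + 1 / y\<^sup>2) - G' y) (at y)"
    if "y > 0" for y
    unfolding u_def using that
    by (auto intro!: derivative_eq_intros has_real_derivative_std_normal_density deriv
             simp: field_simps power2_eq_square)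
  have deriv_nonpos: "- C * std_normal_density y * (1 + 1 / y\<^sup>2) - G' y \<le> 0" for y
  proof -
    have "C * std_normal_density y * 1 \<le> C * std_normal_density y * (1 + 1 / y\<^sup>2)"
      using \<open>0 \<le> C\<close> by (intro mult_left_mono) auto
    then show ?thesis
      using lower[of y] by simp
  qed
  have antimono_u: "u y \<le> u x" if "x \<le> y" for y
  proof (rule DERIV_nonpos_imp_nonincreasing[OF that])
    fix z assume "x \<le> z"
    then show "\<exists>D. (u has_real_derivative D) (at z) \<and> D \<le> 0"
      using deriv_u[of z] deriv_nonpos[of z] \<open>x > 0\<close> by (meson order_less_le_trans)
  qed
  have "(u \<longlongrightarrow> C * 0 - 0) at_top"
    unfolding u_def by (intro tendsto_intros tendsto_std_normal_density_over_id lim)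
  then have "0 \<le> u x"
    using eventually_mono[OF eventually_ge_at_top[of x] antimono_u]
    by (intro tendsto_upperbound[of u 0 at_top]) auto
  then show ?thesis
    by (simp add: u_def)
qed

lemma abs_gaussian_tail_le:
  assumes deriv: "\<And>y. (G has_real_derivative G' y) (at y)"
    and bound: "\<And>y. \<bar>G' y\<bar> \<le> C * std_normal_density y"
    and lim: "(G \<longlongrightarrow> 0) at_top" and "x > 0"
  shows "\<bar>G x\<bar> \<le> C * (std_normal_density x / x)"
proof -
  have "0 \<le> C * std_normal_density 0"
    using abs_ge_zero bound by (rule order_trans)
  then have "0 \<le> C"
    using std_normal_density_pos[of 0] by (simp add: zero_le_mult_iff)
  have "G x \<le> C * (std_normal_density x / x)"
    using deriv _ \<open>0 \<le> C\<close> lim \<open>x > 0\<close>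
  proof (rule gaussian_tail_le)
    show "- (C * std_normal_density y) \<le> G' y" for y
      using bound[of y] by linarith
  qed
  moreover have "- G x \<le> C * (std_normal_density x / x)"
    using DERIV_minus[OF deriv] _ \<open>0 \<le> C\<close> tendsto_minus[OF lim, simplified] \<open>x > 0\<close>
  proof (rule gaussian_tail_le)
    show "- (C * std_normal_density y) \<le> - G' y" for y
      using bound[of y] by linarith
  qed
  ultimately show ?thesis
    by linarith
qed

definition std_normal_centred :: "(real \<Rightarrow> real) \<Rightarrow> real \<Rightarrow> real" where
  "std_normal_centred h x = h x - (LINT t|std_normal_distribution. h t)"

lemma abs_std_normal_centred_le:
  assumes "h \<in> borel_measurable borel" and range: "\<And>x. h x \<in> {a..b}"
  shows "\<bar>std_normal_centred h x\<bar> \<le> b - a"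
proof -
  interpret real_distribution std_normal_distribution
    by (rule real_dist_normal_dist)
  have "integrable std_normal_distribution h"
  proof (rule integrable_const_bound)
    show "AE x in std_normal_distribution. norm (h x) \<le> \<bar>a\<bar> + \<bar>b\<bar>"
    proof (rule AE_I2)
      fix x
      show "norm (h x) \<le> \<bar>a\<bar> + \<bar>b\<bar>"
        using range[of x] by auto
    qed
  qed (use assms(1) in simp)
  then have "(LINT t|std_normal_distribution. h t) \<in> {a..b}"
    using range by (auto intro!: integral_ge_const integral_le_const)
  then show ?thesis
    using range[of x] by (auto simp: std_normal_centred_def abs_le_iff)
qed

definition stein_solution :: "(real \<Rightarrow> real) \<Rightarrow> real \<Rightarrow> real" where
  "stein_solution h x =
     (LINT t:{..x}|lborel. std_normal_centred h t * std_normal_density t) / std_normal_density x"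

definition stein_derivative :: "(real \<Rightarrow> real) \<Rightarrow> real \<Rightarrow> real" where
  "stein_derivative h x = x * stein_solution h x + std_normal_centred h x"

context
  fixes h :: "real \<Rightarrow> real" and C :: real
  assumes continuous: "continuous_on UNIV h"
    and centred_bound: "\<And>x. \<bar>std_normal_centred h x\<bar> \<le> C"
begin

private abbreviation weighted :: "real \<Rightarrow> real" where
  "weighted t \<equiv> std_normal_centred h t * std_normal_density t"

private lemma continuous_weighted: "continuous_on UNIV weighted"
  unfolding std_normal_centred_def std_normal_density_def
  by (intro continuous_intros continuous) auto

private lemma abs_weighted_le: "\<bar>weighted t\<bar> \<le> C * std_normal_density t"
  using centred_bound[of t] std_normal_density_pos[of t] by (simp add: abs_mult mult_right_mono)

private lemma integrable_weighted: "integrable lborel weighted"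
proof (rule Bochner_Integration.integrable_bound)
  show "integrable lborel (\<lambda>t. C * std_normal_density t)"
    by auto
  show "weighted \<in> borel_measurable lborel"
    using borel_measurable_continuous_onI[OF continuous_weighted] by simp
  show "AE t in lborel. norm (weighted t) \<le> norm (C * std_normal_density t)"
    using order_trans[OF abs_weighted_le abs_ge_self] by (intro AE_I2) simp
qed

private lemma integral_weighted: "(LINT t|lborel. weighted t) = 0"
proof -
  interpret real_distribution std_normal_distribution
    by (rule real_dist_normal_dist)
  have [measurable]: "h \<in> borel_measurable borel"
    using continuous by (rule borel_measurable_continuous_onI)
  let ?c = "LINT t|std_normal_distribution. h t"
  have "integrable std_normal_distribution h"
  proof (rule integrable_const_bound)
    show "AE x in std_normal_distribution. norm (h x) \<le> C + \<bar>?c\<bar>"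
    proof (rule AE_I2)
      fix x
      show "norm (h x) \<le> C + \<bar>?c\<bar>"
        using centred_bound[of x] by (simp add: std_normal_centred_def)
    qed
  qed simp
  then have "(LINT t|std_normal_distribution. std_normal_centred h t) = 0"
    using prob_space by (simp add: std_normal_centred_def)
  moreover have "std_normal_centred h \<in> borel_measurable borel"
    unfolding std_normal_centred_def [abs_def] by measurable
  ultimately show ?thesis
    by (subst (asm) integral_density) (auto simp: mult.commute)
qed

lemma has_real_derivative_stein_solution:
  "(stein_solution h has_real_derivative stein_derivative h x) (at x)"
  unfolding stein_solution_def [abs_def] stein_derivative_def using std_normal_density_pos[of x]
  by (auto intro!: derivative_eq_intros has_real_derivative_std_normal_density
        has_real_derivative_set_integral_atMost integrable_weighted continuous_weighted
      simp: field_simps)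

lemma borel_measurable_stein_solution: "stein_solution h \<in> borel_measurable borel"
  using has_real_derivative_stein_solution DERIV_isCont
  by (intro borel_measurable_continuous_onI continuous_at_imp_continuous_on) blast

lemma borel_measurable_stein_derivative: "stein_derivative h \<in> borel_measurable borel"
proof -
  note [measurable] = borel_measurable_continuous_onI[OF continuous] borel_measurable_stein_solution
  show ?thesis
    unfolding stein_derivative_def [abs_def] std_normal_centred_def by measurable
qed

lemma abs_mult_stein_solution_le: "\<bar>x * stein_solution h x\<bar> \<le> C"
proof -
  let ?G = "\<lambda>x. LINT t:{..x}|lborel. weighted t"
  have deriv: "(?G has_real_derivative weighted y) (at y)" for y
    by (intro has_real_derivative_set_integral_atMost integrable_weighted continuous_weighted)
  consider (zero) "x = 0" | (pos) "x > 0" | (neg) "x < 0"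
    by linarith
  then show ?thesis
  proof cases
    case zero
    then show ?thesis
      using abs_ge_zero centred_bound[of 0] by (simp add: order_trans)
  next
    case pos
    have "(?G \<longlongrightarrow> 0) at_top"
      using tendsto_integral_at_top[OF _ integrable_weighted] integral_weighted
      by (simp add: set_lebesgue_integral_def)
    with deriv abs_weighted_le have "\<bar>?G x\<bar> \<le> C * (std_normal_density x / x)"
      using pos by (rule abs_gaussian_tail_le)
    then show ?thesis
      using pos std_normal_density_pos[of x] by (simp add: stein_solution_def abs_mult field_simps)
  next
    case neg
    have "((\<lambda>y. ?G (- y)) has_real_derivative - weighted (- y)) (at y)" for y
      using deriv[of "- y"] by (simp add: DERIV_mirror)
    moreover have "\<bar>- weighted (- y)\<bar> \<le> C * std_normal_density y" for y
      using abs_weighted_le[of "- y"] by (simp add: std_normal_density_minus)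
    moreover have "((\<lambda>y. ?G (- y)) \<longlongrightarrow> 0) at_top"
      using tendsto_set_integral_atMost_at_bot[OF integrable_weighted]
        filterlim_uminus_at_bot_at_top
      by (rule filterlim_compose)
    ultimately have "\<bar>?G (- (- x))\<bar> \<le> C * (std_normal_density (- x) / (- x))"
      using neg by (intro abs_gaussian_tail_le) auto
    then show ?thesis
      using neg std_normal_density_pos[of x]
      by (simp add: stein_solution_def abs_mult std_normal_density_minus field_simps)
  qed
qed

lemma abs_stein_derivative_le: "\<bar>stein_derivative h x\<bar> \<le> 2 * C"
  using abs_mult_stein_solution_le[of x] centred_bound[of x]
  unfolding stein_derivative_def by linarith

lemma abs_stein_solution_diff_le: "\<bar>stein_solution h x - stein_solution h y\<bar> \<le> 2 * C * \<bar>x - y\<bar>"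
  using field_differentiable_bound[of UNIV "stein_solution h" "stein_derivative h" "2 * C" x y]
    has_real_derivative_stein_solution abs_stein_derivative_le by auto

lemma abs_stein_solution_le: "\<bar>stein_solution h x\<bar> \<le> 3 * C"
proof (cases "\<bar>x\<bar> \<ge> 1")
  case True
  have "\<bar>stein_solution h x\<bar> \<le> \<bar>x\<bar> * \<bar>stein_solution h x\<bar>"
    using True by (intro mult_le_cancel_right1[THEN iffD2]) auto
  then show ?thesis
    using abs_mult_stein_solution_le[of x] by (simp add: abs_mult)
next
  case False
  define s :: real where "s = (if x \<ge> 0 then 1 else - 1)"
  have "0 \<le> C"
    using abs_ge_zero centred_bound[of 0] by (rule order_trans)
  moreover have "\<bar>x - s\<bar> \<le> 1" "\<bar>stein_solution h s\<bar> \<le> C"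
    using abs_mult_stein_solution_le[of s] False by (auto simp: s_def)
  ultimately have "2 * C * \<bar>x - s\<bar> \<le> 2 * C * 1"
    by (intro mult_left_mono) auto
  then show ?thesis
    using abs_stein_solution_diff_le[of x s] \<open>\<bar>stein_solution h s\<bar> \<le> C\<close> by linarith
qed

lemma abs_stein_derivative_diff_le:
  "\<bar>stein_derivative h x - stein_derivative h y\<bar> \<le> C * (3 + 2 * \<bar>x\<bar>) * \<bar>x - y\<bar> + \<bar>h x - h y\<bar>"
proof -
  let ?f = "stein_solution h"
  have "\<bar>stein_derivative h x - stein_derivative h y\<bar>
      = \<bar>(x - y) * ?f y + x * (?f x - ?f y) + (h x - h y)\<bar>"
    by (simp add: stein_derivative_def std_normal_centred_def algebra_simps)
  also have "\<dots> \<le> \<bar>x - y\<bar> * \<bar>?f y\<bar> + \<bar>x\<bar> * \<bar>?f x - ?f y\<bar> + \<bar>h x - h y\<bar>"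
    unfolding abs_mult[symmetric] by linarith
  also have "\<dots> \<le> \<bar>x - y\<bar> * (3 * C) + \<bar>x\<bar> * (2 * C * \<bar>x - y\<bar>) + \<bar>h x - h y\<bar>"
    by (intro add_mono mult_left_mono abs_stein_solution_le abs_stein_solution_diff_le) auto
  finally show ?thesis
    by (simp add: algebra_simps)
qed

end

section \<open>Smoothed indicators\<close>

definition ramp :: "real \<Rightarrow> real \<Rightarrow> real \<Rightarrow> real" where
  "ramp z \<epsilon> w = max 0 (min 1 ((z + \<epsilon> - w) / \<epsilon>))"

lemma ramp_bounds: "ramp z \<epsilon> w \<in> {0..1}"
  by (auto simp: ramp_def)

lemma ramp_eq_1: "\<epsilon> > 0 \<Longrightarrow> w \<le> z \<Longrightarrow> ramp z \<epsilon> w = 1"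
  by (simp add: ramp_def field_simps)

lemma ramp_eq_0: "\<epsilon> > 0 \<Longrightarrow> z + \<epsilon> \<le> w \<Longrightarrow> ramp z \<epsilon> w = 0"
  by (simp add: ramp_def field_simps)

lemma continuous_on_ramp: "continuous_on S (ramp z \<epsilon>)"
  unfolding ramp_def [abs_def] divide_inverse by (intro continuous_intros)

lemma borel_measurable_ramp [measurable]: "ramp z \<epsilon> \<in> borel_measurable borel"
  using continuous_on_ramp by (rule borel_measurable_continuous_onI)

lemma abs_ramp_diff_le:
  assumes "\<epsilon> > 0" "\<bar>w - s\<bar> \<le> t"
  shows "\<bar>ramp z \<epsilon> w - ramp z \<epsilon> s\<bar> \<le> t * (indicator {z - t..z + \<epsilon> + t} w / \<epsilon>)"
proof (cases "w \<in> {z - t..z + \<epsilon> + t}")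
  case True
  have "\<bar>ramp z \<epsilon> w - ramp z \<epsilon> s\<bar> \<le> \<bar>(z + \<epsilon> - w) / \<epsilon> - (z + \<epsilon> - s) / \<epsilon>\<bar>"
    unfolding ramp_def by (auto simp: max_def min_def)
  also have "\<dots> = \<bar>w - s\<bar> / \<epsilon>"
    using assms by (simp add: diff_divide_distrib[symmetric] abs_minus_commute)
  also have "\<dots> \<le> t / \<epsilon>"
    using assms by (intro divide_right_mono) auto
  finally show ?thesis
    using True by simp
next
  case False
  then consider "w < z" "s < z" | "w > z + \<epsilon>" "s > z + \<epsilon>"
    using assms by fastforce
  then show ?thesis
    using False assms by cases (auto simp: ramp_eq_0 ramp_eq_1)
qed

lemma cdf_ramp_bounds:
  assumes "real_distribution P" "\<epsilon> > 0"
  shows "cdf P z \<le> (LINT t|P. ramp z \<epsilon> t)" "(LINT t|P. ramp z \<epsilon> t) \<le> cdf P (z + \<epsilon>)"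
proof -
  interpret real_distribution P
    by (rule assms(1))
  have cdf_eq: "cdf P y = (LINT t|P. indicator {..y} t)" for y
    by (simp add: cdf_def2)
  have integrable_ramp: "integrable P (ramp z \<epsilon>)"
    using ramp_bounds by (intro integrable_const_bound[of _ 1]) auto
  have integrable_indicator: "integrable P (indicator {..y} :: real \<Rightarrow> real)" for y
    by (rule integrable_const_bound[of _ 1]) auto
  show "cdf P z \<le> (LINT t|P. ramp z \<epsilon> t)"
    unfolding cdf_eq using ramp_bounds \<open>\<epsilon> > 0\<close>
    by (intro integral_mono integrable_ramp integrable_indicator)
      (auto simp: indicator_def ramp_eq_1)
  show "(LINT t|P. ramp z \<epsilon> t) \<le> cdf P (z + \<epsilon>)"
    unfolding cdf_eq using ramp_bounds \<open>\<epsilon> > 0\<close>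
    by (intro integral_mono integrable_ramp integrable_indicator)
      (auto simp: indicator_def ramp_eq_0)
qed

lemma abs_cdf_diff_le_ramp:
  assumes P: "real_distribution P" and Q: "real_distribution Q" and "\<epsilon> > 0"
    and lipschitz: "\<And>x y. x \<le> y \<Longrightarrow> cdf Q y - cdf Q x \<le> L * (y - x)"
    and ramp: "\<And>y. \<bar>(LINT t|P. ramp y \<epsilon> t) - (LINT t|Q. ramp y \<epsilon> t)\<bar> \<le> r"
  shows "\<bar>cdf P z - cdf Q z\<bar> \<le> r + L * \<epsilon>"
proof -
  have "cdf P z \<le> cdf Q z + (r + L * \<epsilon>)"
    using cdf_ramp_bounds(1)[OF P \<open>\<epsilon> > 0\<close>, of z] cdf_ramp_bounds(2)[OF Q \<open>\<epsilon> > 0\<close>, of z]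
      ramp[of z] lipschitz[of z "z + \<epsilon>"] \<open>\<epsilon> > 0\<close> by simp
  moreover have "cdf Q z \<le> cdf P z + (r + L * \<epsilon>)"
    using cdf_ramp_bounds(2)[OF P \<open>\<epsilon> > 0\<close>, of "z - \<epsilon>"]
      cdf_ramp_bounds(1)[OF Q \<open>\<epsilon> > 0\<close>, of "z - \<epsilon>"]
      ramp[of "z - \<epsilon>"] lipschitz[of "z - \<epsilon>" z] \<open>\<epsilon> > 0\<close> by simp
  ultimately show ?thesis
    by linarith
qed

lemma measure_Icc_le_cdf_error:
  assumes P: "real_distribution P" and "a \<le> b"
    and error: "\<And>x. \<bar>cdf P x - cdf Q x\<bar> \<le> \<delta>"
    and lipschitz: "\<And>x y. x \<le> y \<Longrightarrow> cdf Q y - cdf Q x \<le> L * (y - x)"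
  shows "measure P {a..b} \<le> 2 * \<delta> + L * (b - a)"
proof -
  interpret real_distribution P
    by (rule P)
  have "measure P {a..b} \<le> 2 * \<delta> + L * (b - c)" if "c < a" for c
  proof -
    have "measure P {a..b} \<le> measure P {c<..b}"
      using that by (intro finite_measure_mono) auto
    also have "\<dots> = cdf P b - cdf P c"
      using that \<open>a \<le> b\<close> by (intro cdf_diff_eq[symmetric]) simp
    finally show ?thesis
      using error[of b] error[of c] lipschitz[of c b] that \<open>a \<le> b\<close> by linarith
  qed
  then have "\<forall>\<^sub>F c in at_left a. measure P {a..b} \<le> 2 * \<delta> + L * (b - c)"
    by (simp add: eventually_at_filter)
  moreover have "((\<lambda>c. 2 * \<delta> + L * (b - c)) \<longlongrightarrow> 2 * \<delta> + L * (b - a)) (at_left a)"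
    by (intro tendsto_intros)
  ultimately show ?thesis
    by (intro tendsto_lowerbound) auto
qed

lemma mean_value_between:
  fixes f :: "real \<Rightarrow> real"
  assumes "\<And>x. (f has_real_derivative f' x) (at x)"
  obtains s where "\<bar>w - s\<bar> \<le> \<bar>t\<bar>" "f w - f (w - t) = t * f' s"
proof (cases t "0::real" rule: linorder_cases)
  case equal
  then show thesis
    using that[of w] by simp
next
  case greater
  then obtain s where "w - t < s" "s < w" "f w - f (w - t) = (w - (w - t)) * f' s"
    using MVT2[of "w - t" w f f'] assms by auto
  then show thesis
    using that[of s] by simp
next
  case less
  then obtain s where "w < s" "s < w - t" "f (w - t) - f w = ((w - t) - w) * f' s"
    using MVT2[of w "w - t" f f'] assms by auto
  then show thesis
    using that[of s] by (simp add: algebra_simps)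
qed

definition remainder_weight :: "real \<Rightarrow> real \<Rightarrow> real \<Rightarrow> real \<Rightarrow> real" where
  "remainder_weight z \<epsilon> t w = 3 + 2 * \<bar>w\<bar> + indicator {z - t..z + \<epsilon> + t} w / \<epsilon>"

lemma borel_measurable_remainder_weight [measurable]:
  "remainder_weight z \<epsilon> t \<in> borel_measurable borel"
  unfolding remainder_weight_def [abs_def] by measurable

lemma remainder_weight_shift:
  assumes "\<epsilon> > 0" "\<bar>w - w'\<bar> \<le> s" "t + s \<le> t'"
  shows "remainder_weight z \<epsilon> t w \<le> remainder_weight z \<epsilon> t' w' + 2 * s"
proof -
  have "indicator {z - t..z + \<epsilon> + t} w \<le> (indicator {z - t'..z + \<epsilon> + t'} w' :: real)"
    using assms by (auto simp: indicator_def)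
  then have "indicator {z - t..z + \<epsilon> + t} w / \<epsilon> \<le> indicator {z - t'..z + \<epsilon> + t'} w' / \<epsilon>"
    using \<open>\<epsilon> > 0\<close> by (intro divide_right_mono) auto
  moreover have "\<bar>w\<bar> \<le> \<bar>w'\<bar> + s"
    using assms(2) by linarith
  ultimately show ?thesis
    by (simp add: remainder_weight_def)
qed

lemma abs_centred_ramp_le: "\<bar>std_normal_centred (ramp z \<epsilon>) x\<bar> \<le> 1"
  using abs_std_normal_centred_le[OF borel_measurable_ramp ramp_bounds] by simp

lemmas has_real_derivative_stein_solution_ramp =
  has_real_derivative_stein_solution[OF continuous_on_ramp abs_centred_ramp_le]

lemmas abs_stein_derivative_ramp_le =
  abs_stein_derivative_le[OF continuous_on_ramp abs_centred_ramp_le, simplified]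

lemmas abs_stein_solution_ramp_le =
  abs_stein_solution_le[OF continuous_on_ramp abs_centred_ramp_le, simplified]

lemmas borel_measurable_stein_solution_ramp =
  borel_measurable_stein_solution[OF continuous_on_ramp abs_centred_ramp_le]

lemmas borel_measurable_stein_derivative_ramp =
  borel_measurable_stein_derivative[OF continuous_on_ramp abs_centred_ramp_le]

lemma stein_remainder_le:
  assumes "\<epsilon> > 0"
  shows "\<bar>t * stein_derivative (ramp z \<epsilon>) w
            - (stein_solution (ramp z \<epsilon>) w - stein_solution (ramp z \<epsilon>) (w - t))\<bar>
    \<le> t\<^sup>2 * remainder_weight z \<epsilon> \<bar>t\<bar> w"
proof -
  let ?f = "stein_solution (ramp z \<epsilon>)" and ?f' = "stein_derivative (ramp z \<epsilon>)"
  obtain s where s: "\<bar>w - s\<bar> \<le> \<bar>t\<bar>" "?f w - ?f (w - t) = t * ?f' s"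
    using mean_value_between[of ?f ?f', OF has_real_derivative_stein_solution_ramp] .
  have "\<bar>?f' w - ?f' s\<bar> \<le> (3 + 2 * \<bar>w\<bar>) * \<bar>w - s\<bar> + \<bar>ramp z \<epsilon> w - ramp z \<epsilon> s\<bar>"
    using abs_stein_derivative_diff_le[OF continuous_on_ramp abs_centred_ramp_le] by simp
  also have "\<dots> \<le> (3 + 2 * \<bar>w\<bar>) * \<bar>t\<bar> + \<bar>t\<bar> * (indicator {z - \<bar>t\<bar>..z + \<epsilon> + \<bar>t\<bar>} w / \<epsilon>)"
    using s(1) \<open>\<epsilon> > 0\<close> by (intro add_mono mult_left_mono abs_ramp_diff_le) auto
  also have "\<dots> = \<bar>t\<bar> * remainder_weight z \<epsilon> \<bar>t\<bar> w"
    by (simp add: remainder_weight_def algebra_simps)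
  finally have "\<bar>t\<bar> * \<bar>?f' w - ?f' s\<bar> \<le> \<bar>t\<bar> * (\<bar>t\<bar> * remainder_weight z \<epsilon> \<bar>t\<bar> w)"
    by (intro mult_left_mono) auto
  moreover have "\<bar>t\<bar> * (\<bar>t\<bar> * remainder_weight z \<epsilon> \<bar>t\<bar> w) = t\<^sup>2 * remainder_weight z \<epsilon> \<bar>t\<bar> w"
    by (simp add: power2_eq_square mult.assoc[symmetric])
  ultimately show ?thesis
    unfolding s(2) by (simp only: right_diff_distrib[symmetric] abs_mult)
qed

section \<open>Covariance and bounded random variables\<close>

lemma sum_symmetric_neighbours_le:
  fixes g :: "'i \<Rightarrow> real"
  assumes "finite I" and sym: "\<And>i j. R i j \<longleftrightarrow> R j i"
    and card: "\<And>i. real (card {j \<in> I. R i j}) \<le> K"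
    and nonneg: "\<And>i. i \<in> I \<Longrightarrow> 0 \<le> g i"
  shows "(\<Sum>i\<in>I. \<Sum>j\<in>{j \<in> I. R i j}. g j) \<le> K * (\<Sum>i\<in>I. g i)"
proof -
  have "(\<Sum>i\<in>I. \<Sum>j\<in>{j \<in> I. R i j}. g j) = (\<Sum>j\<in>I. real (card {i \<in> I. R j i}) * g j)"
    using \<open>finite I\<close> sym by (subst sum.swap_restrict) auto
  also have "\<dots> \<le> (\<Sum>j\<in>I. K * g j)"
    by (intro sum_mono mult_right_mono card nonneg)
  finally show ?thesis
    by (simp add: sum_distrib_left)
qed

context prob_space
begin

lemma expectation_abs_le:
  fixes f :: "'a \<Rightarrow> real"
  assumes "integrable M f" "integrable M (\<lambda>\<omega>. (f \<omega>)\<^sup>2)"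
    and "expectation (\<lambda>\<omega>. (f \<omega>)\<^sup>2) \<le> c\<^sup>2" "0 \<le> c"
  shows "expectation (\<lambda>\<omega>. \<bar>f \<omega>\<bar>) \<le> c"
proof -
  have "variance (\<lambda>\<omega>. \<bar>f \<omega>\<bar>) = expectation (\<lambda>\<omega>. (f \<omega>)\<^sup>2) - (expectation (\<lambda>\<omega>. \<bar>f \<omega>\<bar>))\<^sup>2"
    using assms(1,2) by (simp add: variance_eq)
  then have "(expectation (\<lambda>\<omega>. \<bar>f \<omega>\<bar>))\<^sup>2 \<le> expectation (\<lambda>\<omega>. (f \<omega>)\<^sup>2)"
    using variance_positive[of "\<lambda>\<omega>. \<bar>f \<omega>\<bar>"] by linarith
  then show ?thesis
    using assms(3,4) by (meson order_trans power2_le_imp_le)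
qed

definition covariance :: "('a \<Rightarrow> real) \<Rightarrow> ('a \<Rightarrow> real) \<Rightarrow> real" where
  "covariance X Y = expectation (\<lambda>\<omega>. (X \<omega> - expectation X) * (Y \<omega> - expectation Y))"

lemma covariance_self: "covariance X X = variance X"
  by (simp add: covariance_def power2_eq_square)

lemma covariance_commute: "covariance X Y = covariance Y X"
  by (simp add: covariance_def mult.commute)

lemma covariance_eq:
  assumes "integrable M X" "integrable M Y" "integrable M (\<lambda>\<omega>. X \<omega> * Y \<omega>)"
  shows "covariance X Y = expectation (\<lambda>\<omega>. X \<omega> * Y \<omega>) - expectation X * expectation Y"
  using assms by (simp add: covariance_def left_diff_distrib right_diff_distrib prob_space)

lemma variance_sum:
  assumes integrable: "\<And>i. i \<in> I \<Longrightarrow> integrable M (X i)"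
    and integrable_mult: "\<And>i j. i \<in> I \<Longrightarrow> j \<in> I \<Longrightarrow> integrable M (\<lambda>\<omega>. X i \<omega> * X j \<omega>)"
  shows "variance (\<lambda>\<omega>. \<Sum>i\<in>I. X i \<omega>) = (\<Sum>i\<in>I. \<Sum>j\<in>I. covariance (X i) (X j))"
proof -
  let ?Z = "\<lambda>i \<omega>. X i \<omega> - expectation (X i)"
  have integrable_Z: "integrable M (\<lambda>\<omega>. ?Z i \<omega> * ?Z j \<omega>)" if "i \<in> I" "j \<in> I" for i j
    using that by (simp add: left_diff_distrib right_diff_distrib integrable integrable_mult)
  have "variance (\<lambda>\<omega>. \<Sum>i\<in>I. X i \<omega>) = expectation (\<lambda>\<omega>. (\<Sum>i\<in>I. ?Z i \<omega>)\<^sup>2)"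
    by (simp add: integrable sum_subtractf)
  also have "\<dots> = expectation (\<lambda>\<omega>. \<Sum>i\<in>I. \<Sum>j\<in>I. ?Z i \<omega> * ?Z j \<omega>)"
    by (simp add: power2_eq_square sum_product)
  also have "\<dots> = (\<Sum>i\<in>I. \<Sum>j\<in>I. covariance (X i) (X j))"
    unfolding covariance_def by (simp add: Bochner_Integration.integral_sum integrable_Z)
  finally show ?thesis .
qed

lemma covariance_le:
  assumes "integrable M X" "integrable M Y"
    "integrable M (\<lambda>\<omega>. (X \<omega>)\<^sup>2)" "integrable M (\<lambda>\<omega>. (Y \<omega>)\<^sup>2)" "integrable M (\<lambda>\<omega>. X \<omega> * Y \<omega>)"
  shows "covariance X Y \<le> (variance X + variance Y) / 2"
proof -
  let ?X = "\<lambda>\<omega>. X \<omega> - expectation X" and ?Y = "\<lambda>\<omega>. Y \<omega> - expectation Y"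
  have mult_le: "x * y \<le> (x\<^sup>2 + y\<^sup>2) / 2" for x y :: real
    using sum_squares_bound[of x y] by simp
  have integrable_squares: "integrable M (\<lambda>\<omega>. (?X \<omega>)\<^sup>2)" "integrable M (\<lambda>\<omega>. (?Y \<omega>)\<^sup>2)"
    using assms by (simp_all add: power2_diff)
  have "covariance X Y \<le> expectation (\<lambda>\<omega>. ((?X \<omega>)\<^sup>2 + (?Y \<omega>)\<^sup>2) / 2)"
    unfolding covariance_def
  proof (rule integral_mono)
    show "integrable M (\<lambda>\<omega>. ?X \<omega> * ?Y \<omega>)"
      using assms by (simp add: left_diff_distrib right_diff_distrib)
    show "integrable M (\<lambda>\<omega>. ((?X \<omega>)\<^sup>2 + (?Y \<omega>)\<^sup>2) / 2)"
      using integrable_squares by simp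
    show "?X \<omega> * ?Y \<omega> \<le> ((?X \<omega>)\<^sup>2 + (?Y \<omega>)\<^sup>2) / 2" for \<omega>
      by (rule mult_le)
  qed
  then show ?thesis
    using integrable_squares by simp
qed

lemma variance_sum_le:
  assumes "finite I" and sym: "\<And>i j. R i j \<longleftrightarrow> R j i"
    and card: "\<And>i. real (card {j \<in> I. R i j}) \<le> K"
    and integrable: "\<And>i. i \<in> I \<Longrightarrow> integrable M (X i)"
    and integrable_mult: "\<And>i j. i \<in> I \<Longrightarrow> j \<in> I \<Longrightarrow> integrable M (\<lambda>\<omega>. X i \<omega> * X j \<omega>)"
    and uncorrelated: "\<And>i j. i \<in> I \<Longrightarrow> j \<in> I \<Longrightarrow> \<not> R i j \<Longrightarrow> covariance (X i) (X j) = 0"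
  shows "variance (\<lambda>\<omega>. \<Sum>i\<in>I. X i \<omega>) \<le> K * (\<Sum>i\<in>I. variance (X i))"
proof -
  let ?v = "\<lambda>i. variance (X i) / 2"
  have "variance (\<lambda>\<omega>. \<Sum>i\<in>I. X i \<omega>) = (\<Sum>i\<in>I. \<Sum>j\<in>I. covariance (X i) (X j))"
    by (intro variance_sum integrable integrable_mult)
  also have "\<dots> = (\<Sum>i\<in>I. \<Sum>j\<in>{j \<in> I. R i j}. covariance (X i) (X j))"
    using \<open>finite I\<close> by (intro sum.cong refl sum.mono_neutral_right) (auto simp: uncorrelated)
  also have "\<dots> \<le> (\<Sum>i\<in>I. \<Sum>j\<in>{j \<in> I. R i j}. ?v i + ?v j)"
    using covariance_le integrable integrable_mult
    by (intro sum_mono) (auto simp: power2_eq_square add_divide_distrib[symmetric])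
  also have "\<dots> = (\<Sum>i\<in>I. real (card {j \<in> I. R i j}) * ?v i)
      + (\<Sum>i\<in>I. \<Sum>j\<in>{j \<in> I. R i j}. ?v j)"
    by (simp add: sum.distrib)
  also have "\<dots> \<le> (\<Sum>i\<in>I. K * ?v i) + K * (\<Sum>i\<in>I. ?v i)"
    using \<open>finite I\<close> sym card variance_positive
    by (intro add_mono sum_mono mult_right_mono sum_symmetric_neighbours_le) auto
  also have "\<dots> = K * (\<Sum>i\<in>I. variance (X i))"
    by (simp add: sum_distrib_left[symmetric] sum_divide_distrib[symmetric])
  finally show ?thesis .
qed

lemma covariance_indicator:
  assumes "A \<in> events" "B \<in> events"
  shows "covariance (indicator A) (indicator B) = prob (A \<inter> B) - prob A * prob B"
proof -
  have "(\<lambda>\<omega>. indicator A \<omega> * indicator B \<omega> :: real) = indicator (A \<inter> B)"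
    by (auto simp: indicator_def)
  then show ?thesis
    using assms by (subst covariance_eq) (auto simp: emeasure_eq_measure)
qed

definition bounded_rv :: "('a \<Rightarrow> real) \<Rightarrow> bool" where
  "bounded_rv f \<longleftrightarrow> f \<in> borel_measurable M \<and> (\<exists>c. \<forall>\<omega>\<in>space M. \<bar>f \<omega>\<bar> \<le> c)"

lemma bounded_rvI:
  assumes "f \<in> borel_measurable M" "\<And>\<omega>. \<omega> \<in> space M \<Longrightarrow> \<bar>f \<omega>\<bar> \<le> c"
  shows "bounded_rv f"
  using assms by (auto simp: bounded_rv_def)

lemma bounded_rv_bound:
  assumes "bounded_rv f"
  shows "\<exists>c\<ge>0. \<forall>\<omega>\<in>space M. \<bar>f \<omega>\<bar> \<le> c"
proof -
  obtain c where "\<forall>\<omega>\<in>space M. \<bar>f \<omega>\<bar> \<le> c"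
    using assms by (auto simp: bounded_rv_def)
  then show ?thesis
    by (intro exI[of _ "max 0 c"]) (auto simp: le_max_iff_disj)
qed

lemma bounded_rv_if_abs_diff_le:
  assumes "f \<in> borel_measurable M" "\<And>\<omega>. \<omega> \<in> space M \<Longrightarrow> \<bar>f \<omega> - a\<bar> \<le> c"
  shows "bounded_rv f"
proof (rule bounded_rvI[OF assms(1)])
  show "\<bar>f \<omega>\<bar> \<le> \<bar>a\<bar> + c" if "\<omega> \<in> space M" for \<omega>
    using assms(2)[OF that] by linarith
qed

lemma borel_measurable_bounded_rv: "bounded_rv f \<Longrightarrow> f \<in> borel_measurable M"
  by (simp add: bounded_rv_def)

lemma integrable_bounded_rv [simp]: "bounded_rv f \<Longrightarrow> integrable M f"
  by (auto simp: bounded_rv_def intro!: integrable_const_bound AE_I2)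

lemma bounded_rv_const [simp]: "bounded_rv (\<lambda>_. c)"
  by (rule bounded_rvI) auto

lemma bounded_rv_indicator [simp]: "A \<in> events \<Longrightarrow> bounded_rv (indicator A)"
  by (rule bounded_rvI[where c = 1]) auto

lemma bounded_rv_compose:
  assumes "f \<in> borel_measurable M" "g \<in> borel_measurable borel" "\<And>x. \<bar>g x\<bar> \<le> c"
  shows "bounded_rv (\<lambda>\<omega>. g (f \<omega>))"
  using assms by (intro bounded_rvI) auto

lemma bounded_rv_add [simp]:
  assumes "bounded_rv f" "bounded_rv g"
  shows "bounded_rv (\<lambda>\<omega>. f \<omega> + g \<omega>)"
proof -
  obtain a where f: "\<And>\<omega>. \<omega> \<in> space M \<Longrightarrow> \<bar>f \<omega>\<bar> \<le> a"
    using bounded_rv_bound[OF assms(1)] by blast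
  obtain b where g: "\<And>\<omega>. \<omega> \<in> space M \<Longrightarrow> \<bar>g \<omega>\<bar> \<le> b"
    using bounded_rv_bound[OF assms(2)] by blast
  have "\<bar>f \<omega> + g \<omega>\<bar> \<le> a + b" if "\<omega> \<in> space M" for \<omega>
    using f[OF that] g[OF that] by linarith
  then show ?thesis
    using assms[THEN borel_measurable_bounded_rv] by (intro bounded_rvI) auto
qed

lemma bounded_rv_mult [simp]:
  assumes "bounded_rv f" "bounded_rv g"
  shows "bounded_rv (\<lambda>\<omega>. f \<omega> * g \<omega>)"
proof -
  obtain a where f: "0 \<le> a" "\<And>\<omega>. \<omega> \<in> space M \<Longrightarrow> \<bar>f \<omega>\<bar> \<le> a"
    using bounded_rv_bound[OF assms(1)] by blast
  obtain b where g: "\<And>\<omega>. \<omega> \<in> space M \<Longrightarrow> \<bar>g \<omega>\<bar> \<le> b"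
    using bounded_rv_bound[OF assms(2)] by blast
  have "\<bar>f \<omega> * g \<omega>\<bar> \<le> a * b" if "\<omega> \<in> space M" for \<omega>
    unfolding abs_mult using f g that by (intro mult_mono) auto
  then show ?thesis
    using assms[THEN borel_measurable_bounded_rv] by (intro bounded_rvI) auto
qed

lemma bounded_rv_abs [simp]: "bounded_rv f \<Longrightarrow> bounded_rv (\<lambda>\<omega>. \<bar>f \<omega>\<bar>)"
  by (auto simp: bounded_rv_def)

lemma bounded_rv_minus [simp]: "bounded_rv f \<Longrightarrow> bounded_rv (\<lambda>\<omega>. - f \<omega>)"
  by (auto simp: bounded_rv_def)

lemma bounded_rv_diff [simp]:
  "bounded_rv f \<Longrightarrow> bounded_rv g \<Longrightarrow> bounded_rv (\<lambda>\<omega>. f \<omega> - g \<omega>)"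
  using bounded_rv_add[of f "\<lambda>\<omega>. - g \<omega>"] by simp

lemma bounded_rv_divide [simp]: "bounded_rv f \<Longrightarrow> bounded_rv (\<lambda>\<omega>. f \<omega> / c)"
  using bounded_rv_mult[of f "\<lambda>_. 1 / c"] by simp

lemma bounded_rv_square [simp]: "bounded_rv f \<Longrightarrow> bounded_rv (\<lambda>\<omega>. (f \<omega>)\<^sup>2)"
  by (simp add: power2_eq_square)

lemma bounded_rv_sum [simp]:
  "(\<And>i. i \<in> I \<Longrightarrow> bounded_rv (f i)) \<Longrightarrow> bounded_rv (\<lambda>\<omega>. \<Sum>i\<in>I. f i \<omega>)"
  by (induction I rule: infinite_finite_induct) auto

lemma expectation_mono_bounded_rv:
  assumes "bounded_rv f" "bounded_rv g" "\<And>\<omega>. \<omega> \<in> space M \<Longrightarrow> f \<omega> \<le> g \<omega>"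
  shows "expectation f \<le> expectation g"
  using assms by (intro integral_mono) auto

section \<open>m-dependence\<close>

definition generated_sigma :: "('i \<Rightarrow> 'a \<Rightarrow> real) \<Rightarrow> 'i set \<Rightarrow> 'a measure" where
  "generated_sigma X I = sigma (space M) (\<Union>i\<in>I. {X i -` A \<inter> space M | A. A \<in> sets borel})"

lemma space_generated_sigma [simp]: "space (generated_sigma X I) = space M"
  unfolding generated_sigma_def by (rule space_measure_of) auto

lemma sets_generated_sigma:
  "sets (generated_sigma X I)
    = sigma_sets (space M) (\<Union>i\<in>I. {X i -` A \<inter> space M | A. A \<in> sets borel})"
  unfolding generated_sigma_def by (rule sets_measure_of) auto

lemma measurable_generated_sigma: "i \<in> I \<Longrightarrow> X i \<in> borel_measurable (generated_sigma X I)"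
  by (intro measurableI) (auto simp: sets_generated_sigma intro: sigma_sets.Basic)

lemma sets_generated_sigma_subset:
  assumes "space F = space M" "\<And>i. i \<in> I \<Longrightarrow> X i \<in> borel_measurable F"
  shows "sets (generated_sigma X I) \<subseteq> sets F"
  unfolding sets_generated_sigma assms(1)[symmetric]
  using measurable_sets[OF assms(2)] by (intro sets.sigma_sets_subset) auto

lemma sets_generated_sigma_mono: "I \<subseteq> J \<Longrightarrow> sets (generated_sigma X I) \<subseteq> sets (generated_sigma X J)"
  by (intro sets_generated_sigma_subset measurable_generated_sigma) auto

lemma sets_generated_sigma_Un:
  "sets (generated_sigma X (I \<union> J)) \<subseteq> sigma_sets (space M)
     {A \<inter> B | A B. A \<in> sets (generated_sigma X I) \<and> B \<in> sets (generated_sigma X J)}"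
  (is "_ \<subseteq> sigma_sets _ ?rectangles")
proof -
  have "A \<in> ?rectangles" if "A \<in> sets (generated_sigma X I)" for A
  proof -
    have "A = A \<inter> space M" "space M \<in> sets (generated_sigma X J)"
      using sets.sets_into_space[OF that] sets.top[of "generated_sigma X J"] by auto
    with that show ?thesis
      by blast
  qed
  moreover have "A \<in> ?rectangles" if "A \<in> sets (generated_sigma X J)" for A
  proof -
    have "A = space M \<inter> A" "space M \<in> sets (generated_sigma X I)"
      using sets.sets_into_space[OF that] sets.top[of "generated_sigma X I"] by auto
    with that show ?thesis
      by blast
  qed
  moreover have "X i -` A \<inter> space M \<in> sets (generated_sigma X K)"
    if "i \<in> K" "A \<in> sets borel" for i A K
    using measurable_sets[OF measurable_generated_sigma[OF that(1)] that(2), of X] by simp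
  ultimately have "X i -` A \<inter> space M \<in> ?rectangles" if "i \<in> I \<union> J" "A \<in> sets borel" for i A
    using that by (metis (no_types, lifting) Un_iff)
  then show ?thesis
    unfolding sets_generated_sigma by (intro sigma_sets_mono') blast
qed

lemma indep_set_mono:
  assumes "indep_set A B" "A' \<subseteq> A" "B' \<subseteq> B"
  shows "indep_set A' B'"
  using assms unfolding indep_sets2_eq by blast

lemma indep_varI:
  assumes "random_variable M1 U" "random_variable M2 V"
    and prob: "\<And>A B. A \<in> sets M1 \<Longrightarrow> B \<in> sets M2 \<Longrightarrow>
      prob ((U -` A \<inter> space M) \<inter> (V -` B \<inter> space M))
        = prob (U -` A \<inter> space M) * prob (V -` B \<inter> space M)"
  shows "indep_var M1 U M2 V"
proof -
  let ?preimages = "\<lambda>f N. {f -` A \<inter> space M | A. A \<in> sets N}"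
  have "Int_stable (?preimages f N)" for f :: "'a \<Rightarrow> 'c" and N
  proof (rule Int_stableI)
    fix C D assume "C \<in> ?preimages f N" "D \<in> ?preimages f N"
    then obtain A B where "A \<in> sets N" "B \<in> sets N" "C \<inter> D = f -` (A \<inter> B) \<inter> space M"
      by auto
    then show "C \<inter> D \<in> ?preimages f N"
      by blast
  qed
  moreover have "indep_set (?preimages U M1) (?preimages V M2)"
    using assms(1,2) by (intro indep_setI) (auto simp: prob)
  ultimately show ?thesis
    unfolding indep_var_eq using assms(1,2) by (intro conjI indep_set_sigma_sets) auto
qed

lemma indep_set_generated_sigma:
  assumes "indep_var M1 U M2 V"
    and "\<And>i. i \<in> I \<Longrightarrow> X i \<in> borel_measurable (vimage_algebra (space M) U M1)"
    and "\<And>j. j \<in> J \<Longrightarrow> X j \<in> borel_measurable (vimage_algebra (space M) V M2)"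
  shows "indep_set (sets (generated_sigma X I)) (sets (generated_sigma X J))"
proof -
  have "indep_set (sets (vimage_algebra (space M) U M1)) (sets (vimage_algebra (space M) V M2))"
    using assms(1) unfolding indep_var_eq vimage_algebra_def
    by (subst (1 2) sets_measure_of) auto
  then show ?thesis
    by (rule indep_set_mono) (intro sets_generated_sigma_subset assms; simp)+
qed

lemma expectation_mult_indep:
  assumes indep: "indep_set (sets F) (sets G)"
    and spaces: "space F = space M" "space G = space M"
    and measurable: "U \<in> borel_measurable F" "V \<in> borel_measurable G"
    and integrable: "integrable M U" "integrable M V"
  shows "expectation (\<lambda>\<omega>. U \<omega> * V \<omega> :: real) = expectation U * expectation V"
proof -
  have "sigma_sets (space M) {U -` A \<inter> space M |A. A \<in> sets borel} \<subseteq> sets F"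
    unfolding spaces(1)[symmetric] using measurable_sets[OF measurable(1)]
    by (intro sets.sigma_sets_subset) auto
  moreover have "sigma_sets (space M) {V -` A \<inter> space M |A. A \<in> sets borel} \<subseteq> sets G"
    unfolding spaces(2)[symmetric] using measurable_sets[OF measurable(2)]
    by (intro sets.sigma_sets_subset) auto
  ultimately have "indep_var borel U borel V"
    unfolding indep_var_eq using integrable indep_set_mono[OF indep]
    by (simp add: borel_measurable_integrable)
  then show ?thesis
    using integrable by (rule indep_var_lebesgue_integral)
qed

definition m_dependent :: "nat \<Rightarrow> nat \<Rightarrow> (nat \<Rightarrow> 'a \<Rightarrow> real) \<Rightarrow> bool" where
  "m_dependent d N X \<longleftrightarrow> (\<forall>a. indep_set
     (sets (generated_sigma X {j. j < N \<and> j + d < a})) (sets (generated_sigma X {a..<N})))"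

lemma borel_measurable_m_dependent:
  assumes "m_dependent d N X" "i < N"
  shows "X i \<in> borel_measurable M"
proof (rule borel_measurable_subalgebra)
  show "sets (generated_sigma X {0..<N}) \<subseteq> events"
    using assms(1) indep_setD_ev2 unfolding m_dependent_def by blast
  show "X i \<in> borel_measurable (generated_sigma X {0..<N})"
    using assms(2) by (intro measurable_generated_sigma) simp
qed simp

lemma m_dependent_compose:
  assumes "m_dependent d N X" "\<And>i. i < N \<Longrightarrow> f i \<in> borel_measurable borel"
  shows "m_dependent d N (\<lambda>i \<omega>. f i (X i \<omega>))"
  unfolding m_dependent_def
proof
  fix a
  have subset: "sets (generated_sigma (\<lambda>i \<omega>. f i (X i \<omega>)) I) \<subseteq> sets (generated_sigma X I)"
    if "I \<subseteq> {..<N}" for I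
    using that by (intro sets_generated_sigma_subset
        measurable_compose[OF measurable_generated_sigma assms(2)]) auto
  show "indep_set (sets (generated_sigma (\<lambda>i \<omega>. f i (X i \<omega>)) {j. j < N \<and> j + d < a}))
      (sets (generated_sigma (\<lambda>i \<omega>. f i (X i \<omega>)) {a..<N}))"
    using assms(1)[unfolded m_dependent_def, rule_format, of a]
    by (rule indep_set_mono) (rule subset; auto)+
qed

lemma indep_set_rectangles:
  assumes "space F = space M"
    and events: "sets F \<subseteq> events" "sets H \<subseteq> events" "sets K \<subseteq> events"
    and indep: "\<And>A B C. A \<in> sets F \<Longrightarrow> B \<in> sets H \<Longrightarrow> C \<in> sets K \<Longrightarrow>
      prob (A \<inter> (B \<inter> C)) = prob A * prob (B \<inter> C)"
  shows "indep_set (sets F) (sigma_sets (space M) {B \<inter> C | B C. B \<in> sets H \<and> C \<in> sets K})"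
    (is "indep_set _ (sigma_sets _ ?rectangles)")
proof -
  have "Int_stable ?rectangles"
  proof (rule Int_stableI)
    fix D E assume "D \<in> ?rectangles" "E \<in> ?rectangles"
    then obtain B C B' C' where "B \<in> sets H" "B' \<in> sets H" "C \<in> sets K" "C' \<in> sets K"
      and "D \<inter> E = (B \<inter> B') \<inter> (C \<inter> C')"
      by blast
    then show "D \<inter> E \<in> ?rectangles"
      by blast
  qed
  moreover have "Int_stable (sets F)"
    by (auto simp: Int_stable_def)
  moreover have "indep_set (sets F) ?rectangles"
  proof (rule indep_setI)
    show "?rectangles \<subseteq> events"
      using events by blast
  qed (use events indep in auto)
  ultimately have "indep_set (sigma_sets (space M) (sets F)) (sigma_sets (space M) ?rectangles)"
    by (intro indep_set_sigma_sets)
  then show ?thesis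
    by (simp add: assms(1)[symmetric] sets.sigma_sets_eq)
qed

text \<open>
  The block \<open>I\<close> is independent of the remote past and future jointly: the remote past is independent
  of the block together with the remote future, and the block is independent of the remote future.
\<close>

lemma indep_set_m_dependent:
  assumes "m_dependent d N X" "a \<le> b"
    and "I \<subseteq> {a..<b} \<inter> {..<N}" "J \<subseteq> {j. j + d < a \<or> b + d \<le> j} \<inter> {..<N}"
  shows "indep_set (sets (generated_sigma X I)) (sets (generated_sigma X J))"
proof -
  let ?\<F> = "\<lambda>K. sets (generated_sigma X K)"
  define past future where "past = {j. j < N \<and> j + d < a}" and "future = {b + d..<N}"
  have indep_past: "indep_set (?\<F> past) (?\<F> (I \<union> future))"
    using assms(1)[unfolded m_dependent_def, rule_format, of a]
    by (rule indep_set_mono)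
      (rule sets_generated_sigma_mono;
        use assms(2,3) in \<open>auto simp: past_def future_def subset_iff\<close>)+
  have indep_future: "indep_set (?\<F> I) (?\<F> future)"
    using assms(1)[unfolded m_dependent_def, rule_format, of "b + d"]
    by (rule indep_set_mono)
      (rule sets_generated_sigma_mono; use assms(3) in \<open>auto simp: future_def subset_iff\<close>)+
  have "prob (A \<inter> (B \<inter> C)) = prob A * prob (B \<inter> C)"
    if "A \<in> ?\<F> I" "B \<in> ?\<F> past" "C \<in> ?\<F> future" for A B C
  proof -
    have mono: "A \<in> ?\<F> (I \<union> future)" "C \<in> ?\<F> (I \<union> future)"
      using that sets_generated_sigma_mono[of _ "I \<union> future"] by blast+
    have "prob (A \<inter> (B \<inter> C)) = prob (B \<inter> (A \<inter> C))"
      by (simp add: Int_left_commute)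
    also have "\<dots> = prob B * (prob A * prob C)"
      using that mono by (simp add: indep_setD[OF indep_past] indep_setD[OF indep_future])
    also have "\<dots> = prob A * prob (B \<inter> C)"
      using that mono by (simp add: indep_setD[OF indep_past])
    finally show ?thesis .
  qed
  then have "indep_set (?\<F> I) (sigma_sets (space M) {B \<inter> C | B C. B \<in> ?\<F> past \<and> C \<in> ?\<F> future})"
    using indep_setD_ev1[OF indep_future] indep_setD_ev1[OF indep_past]
      indep_setD_ev2[OF indep_future]
    by (intro indep_set_rectangles) auto
  moreover have "?\<F> J \<subseteq> ?\<F> (past \<union> future)"
    using assms(4) by (intro sets_generated_sigma_mono) (auto simp: past_def future_def)
  ultimately show ?thesis
    using sets_generated_sigma_Un by (blast intro: indep_set_mono)
qed

lemma covariance_m_dependent: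
  assumes "m_dependent d N X" "i + d < j" "j < N" "bounded_rv (X i)" "bounded_rv (X j)"
  shows "covariance (X i) (X j) = 0"
proof -
  have "indep_set (sets (generated_sigma X {i})) (sets (generated_sigma X {j}))"
    using assms by (intro indep_set_m_dependent[where a = i and b = "Suc i"]) auto
  then have "expectation (\<lambda>\<omega>. X i \<omega> * X j \<omega>) = expectation (X i) * expectation (X j)"
    by (rule expectation_mult_indep) (use assms(4,5) in \<open>auto intro: measurable_generated_sigma\<close>)
  then show ?thesis
    using assms by (simp add: covariance_eq)
qed

end

section \<open>Normal approximation of sums of m-dependent random variables\<close>

locale m_dependent_sum = prob_space +
  fixes X :: "nat \<Rightarrow> 'a \<Rightarrow> real" and N d :: nat and A :: real
  assumes m_dependent: "m_dependent d N X"
    and mean_zero: "\<And>i. i < N \<Longrightarrow> expectation (X i) = 0"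
    and bounded: "\<And>i \<omega>. i < N \<Longrightarrow> \<omega> \<in> space M \<Longrightarrow> \<bar>X i \<omega>\<bar> \<le> A"
    and unit_variance: "variance (\<lambda>\<omega>. \<Sum>i<N. X i \<omega>) = 1"
begin

lemma bounded_rv_X [simp]: "i < N \<Longrightarrow> bounded_rv (X i)"
  using bounded borel_measurable_m_dependent[OF m_dependent] by (intro bounded_rvI)

definition W :: "'a \<Rightarrow> real" where
  "W \<omega> = (\<Sum>i<N. X i \<omega>)"

lemma bounded_rv_W [simp]: "bounded_rv W"
  unfolding W_def [abs_def] by (intro bounded_rv_sum) simp

lemma borel_measurable_W [measurable]: "W \<in> borel_measurable M"
  by (intro borel_measurable_bounded_rv bounded_rv_W)

lemma expectation_W_sq: "expectation (\<lambda>\<omega>. (W \<omega>)\<^sup>2) = 1"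
  using unit_variance mean_zero by (simp add: W_def)

lemma expectation_abs_W_le: "expectation (\<lambda>\<omega>. \<bar>W \<omega>\<bar>) \<le> 1"
  by (intro expectation_abs_le) (simp_all add: expectation_W_sq)

definition nbhd :: "nat \<Rightarrow> nat \<Rightarrow> nat set" where
  "nbhd r i = {j \<in> {..<N}. j \<le> i + r \<and> i \<le> j + r}"

lemma nbhd_subset: "nbhd r i \<subseteq> {..<N}"
  by (auto simp: nbhd_def)

lemma card_nbhd_le: "real (card (nbhd r i)) \<le> 2 * real r + 1"
proof -
  have "card (nbhd r i) \<le> card {i - r..i + r}"
    by (intro card_mono) (auto simp: nbhd_def)
  also have "\<dots> \<le> 2 * r + 1"
    by simp
  finally show ?thesis
    by linarith
qed

lemma sum_nbhd_le:
  assumes "\<And>j. j < N \<Longrightarrow> 0 \<le> g j"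
  shows "(\<Sum>i<N. \<Sum>j\<in>nbhd r i. g j) \<le> (2 * real r + 1) * (\<Sum>j<N. g j)"
  unfolding nbhd_def using assms card_nbhd_le[unfolded nbhd_def]
  by (intro sum_symmetric_neighbours_le) auto

lemma variance_sum_nbhd_le:
  assumes "\<And>i. i < N \<Longrightarrow> bounded_rv (Z i)"
    and "\<And>i j. i < N \<Longrightarrow> j < N \<Longrightarrow> j \<notin> nbhd r i \<Longrightarrow> covariance (Z i) (Z j) = 0"
  shows "variance (\<lambda>\<omega>. \<Sum>i<N. Z i \<omega>) \<le> (2 * real r + 1) * (\<Sum>i<N. variance (Z i))"
  using assms card_nbhd_le[of r]
  by (intro variance_sum_le[where R = "\<lambda>i j. j \<le> i + r \<and> i \<le> j + r"]) (auto simp: nbhd_def)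

lemma expectation_mult_far:
  assumes "U \<in> borel_measurable (generated_sigma X (nbhd r i))"
    and "V \<in> borel_measurable (generated_sigma X ({..<N} - nbhd (r + d) i))"
    and "bounded_rv U" "bounded_rv V"
  shows "expectation (\<lambda>\<omega>. U \<omega> * V \<omega>) = expectation U * expectation V"
proof (rule expectation_mult_indep)
  show "indep_set (sets (generated_sigma X (nbhd r i)))
      (sets (generated_sigma X ({..<N} - nbhd (r + d) i)))"
    by (rule indep_set_m_dependent[OF m_dependent, of "i - r" "i + r + 1"]) (auto simp: nbhd_def)
qed (use assms in auto)

definition local_sum :: "nat \<Rightarrow> nat \<Rightarrow> 'a \<Rightarrow> real" where
  "local_sum r i \<omega> = (\<Sum>j\<in>nbhd r i. X j \<omega>)"

lemma bounded_rv_local_sum [simp]: "bounded_rv (local_sum r i)"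
  unfolding local_sum_def [abs_def] using nbhd_subset by (intro bounded_rv_sum bounded_rv_X) blast

lemma measurable_local_sum:
  "nbhd r i \<subseteq> I \<Longrightarrow> local_sum r i \<in> borel_measurable (generated_sigma X I)"
  unfolding local_sum_def [abs_def]
  by (intro borel_measurable_sum measurable_generated_sigma) auto

lemma W_minus_local_sum: "W \<omega> - local_sum r i \<omega> = (\<Sum>j\<in>{..<N} - nbhd r i. X j \<omega>)"
  unfolding W_def local_sum_def using nbhd_subset by (simp add: sum_diff)

lemma measurable_W_minus_local_sum:
  "(\<lambda>\<omega>. W \<omega> - local_sum r i \<omega>) \<in> borel_measurable (generated_sigma X ({..<N} - nbhd r i))"
  unfolding W_minus_local_sum by (intro borel_measurable_sum measurable_generated_sigma) auto

lemma expectation_X_mult_far: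
  assumes "i < N" "V \<in> borel_measurable (generated_sigma X ({..<N} - nbhd d i))" "bounded_rv V"
  shows "expectation (\<lambda>\<omega>. X i \<omega> * V \<omega>) = 0"
proof -
  have "expectation (\<lambda>\<omega>. X i \<omega> * V \<omega>) = expectation (X i) * expectation V"
    using assms by (intro expectation_mult_far[where r = 0 and i = i] measurable_generated_sigma)
      (auto simp: nbhd_def)
  then show ?thesis
    using mean_zero[OF assms(1)] by simp
qed

definition sum_variances :: real where
  "sum_variances = (\<Sum>i<N. expectation (\<lambda>\<omega>. (X i \<omega>)\<^sup>2))"

lemma sum_variances_ge: "1 \<le> (2 * real d + 1) * sum_variances"
proof -
  have "covariance (X i) (X j) = 0" if "i < N" "j < N" "j \<notin> nbhd d i" for i j
    using that expectation_X_mult_far[of i "X j"]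
    by (simp add: covariance_eq mean_zero measurable_generated_sigma)
  then have "variance (\<lambda>\<omega>. \<Sum>i<N. X i \<omega>) \<le> (2 * real d + 1) * (\<Sum>i<N. variance (X i))"
    by (intro variance_sum_nbhd_le) auto
  then show ?thesis
    using unit_variance by (simp add: sum_variances_def mean_zero)
qed

lemma sum_variances_pos: "sum_variances > 0"
  using sum_variances_ge by (smt (verit) mult_nonneg_nonpos of_nat_0_le_iff)

lemma bound_pos: "A > 0"
proof (rule ccontr)
  assume "\<not> A > 0"
  then have "X i \<omega> = 0" if "i < N" "\<omega> \<in> space M" for i \<omega>
    using bounded[OF that] by simp
  then have "expectation (\<lambda>\<omega>. (X i \<omega>)\<^sup>2) = 0" if "i < N" for i
    using that by (subst Bochner_Integration.integral_cong[where g = "\<lambda>_. 0", OF refl]) auto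
  then show False
    using sum_variances_pos by (simp add: sum_variances_def)
qed

definition rate :: real where
  "rate = (2 * real d + 1)\<^sup>2 * sum_variances * A"

lemma rate_pos: "rate > 0"
  using sum_variances_pos bound_pos by (simp add: rate_def)

lemma width_le_rate: "(2 * real d + 1) * A \<le> rate"
proof -
  have "((2 * real d + 1) * A) * 1 \<le> ((2 * real d + 1) * A) * ((2 * real d + 1) * sum_variances)"
    using sum_variances_ge bound_pos by (intro mult_left_mono) auto
  then show ?thesis
    by (simp add: rate_def power2_eq_square mult_ac)
qed

lemma abs_local_sum_le:
  assumes "\<omega> \<in> space M"
  shows "\<bar>local_sum r i \<omega>\<bar> \<le> (2 * real r + 1) * A"
proof -
  have "\<bar>local_sum r i \<omega>\<bar> \<le> (\<Sum>j\<in>nbhd r i. \<bar>X j \<omega>\<bar>)"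
    unfolding local_sum_def by (rule sum_abs)
  also have "\<dots> \<le> (\<Sum>j\<in>nbhd r i. A)"
    using assms nbhd_subset by (intro sum_mono bounded) auto
  also have "\<dots> \<le> (2 * real r + 1) * A"
    using card_nbhd_le[of r i] bound_pos by simp
  finally show ?thesis .
qed

lemma abs_local_sum_le_rate:
  assumes "\<omega> \<in> space M"
  shows "\<bar>local_sum d i \<omega>\<bar> \<le> rate" "\<bar>local_sum (d + d) i \<omega>\<bar> \<le> 2 * rate"
proof -
  show "\<bar>local_sum d i \<omega>\<bar> \<le> rate"
    using abs_local_sum_le[OF assms, of d i] width_le_rate by (rule order_trans)
  have "\<bar>local_sum (d + d) i \<omega>\<bar> \<le> (2 * real (d + d) + 1) * A"
    using assms by (rule abs_local_sum_le)
  also have "\<dots> \<le> 2 * ((2 * real d + 1) * A)"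
    using bound_pos by (simp add: algebra_simps)
  finally show "\<bar>local_sum (d + d) i \<omega>\<bar> \<le> 2 * rate"
    using width_le_rate by linarith
qed

definition local_product :: "nat \<Rightarrow> 'a \<Rightarrow> real" where
  "local_product i \<omega> = X i \<omega> * local_sum d i \<omega>"

lemma bounded_rv_local_product [simp]: "i < N \<Longrightarrow> bounded_rv (local_product i)"
  unfolding local_product_def [abs_def] by simp

lemma measurable_local_product:
  assumes "i < N" "nbhd d i \<subseteq> I"
  shows "local_product i \<in> borel_measurable (generated_sigma X I)"
proof -
  have "i \<in> I"
    using assms by (auto simp: nbhd_def)
  then show ?thesis
    unfolding local_product_def [abs_def] using assms
    by (intro borel_measurable_times measurable_generated_sigma measurable_local_sum)
qed

lemma sum_expectation_local_product: "(\<Sum>i<N. expectation (local_product i)) = 1"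
proof -
  have "expectation (local_product i) = expectation (\<lambda>\<omega>. X i \<omega> * W \<omega>)" if "i < N" for i
    using expectation_X_mult_far[OF that measurable_W_minus_local_sum] that
    by (simp add: local_product_def [abs_def] right_diff_distrib)
  then have "(\<Sum>i<N. expectation (local_product i)) = expectation (\<lambda>\<omega>. \<Sum>i<N. X i \<omega> * W \<omega>)"
    by (simp add: Bochner_Integration.integral_sum)
  also have "\<dots> = expectation (\<lambda>\<omega>. (W \<omega>)\<^sup>2)"
    by (simp only: W_def power2_eq_square sum_distrib_right)
  finally show ?thesis
    by (simp add: expectation_W_sq)
qed

lemma variance_local_product_le:
  assumes "i < N"
  shows "variance (local_product i) \<le> ((2 * real d + 1) * A)\<^sup>2 * expectation (\<lambda>\<omega>. (X i \<omega>)\<^sup>2)"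
proof -
  have "variance (local_product i) \<le> expectation (\<lambda>\<omega>. (local_product i \<omega>)\<^sup>2)"
    using assms by (simp add: variance_eq)
  also have "\<dots> \<le> expectation (\<lambda>\<omega>. ((2 * real d + 1) * A)\<^sup>2 * (X i \<omega>)\<^sup>2)"
  proof (rule expectation_mono_bounded_rv)
    fix \<omega> assume "\<omega> \<in> space M"
    then have "(local_sum d i \<omega>)\<^sup>2 \<le> ((2 * real d + 1) * A)\<^sup>2"
      using power_mono[OF abs_local_sum_le, of \<omega> d i 2] by simp
    then show "(local_product i \<omega>)\<^sup>2 \<le> ((2 * real d + 1) * A)\<^sup>2 * (X i \<omega>)\<^sup>2"
      by (simp add: local_product_def power_mult_distrib mult.commute mult_left_mono)
  qed (use assms in auto)
  finally show ?thesis
    by simp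
qed

lemma covariance_local_product_far:
  assumes "i < N" "k < N" "k \<notin> nbhd (3 * d) i"
  shows "covariance (local_product i) (local_product k) = 0"
proof -
  have "nbhd d k \<subseteq> {..<N} - nbhd (d + d) i"
    using assms by (auto simp: nbhd_def)
  then have "expectation (\<lambda>\<omega>. local_product i \<omega> * local_product k \<omega>)
      = expectation (local_product i) * expectation (local_product k)"
    using assms
    by (intro expectation_mult_far[where r = d and i = i] measurable_local_product) auto
  then show ?thesis
    using assms by (simp add: covariance_eq)
qed

lemma variance_sum_local_product_le: "variance (\<lambda>\<omega>. \<Sum>i<N. local_product i \<omega>) \<le> 3 * rate\<^sup>2"
proof -
  let ?D = "2 * real d + 1"
  have "variance (\<lambda>\<omega>. \<Sum>i<N. local_product i \<omega>)
      \<le> (2 * real (3 * d) + 1) * (\<Sum>i<N. variance (local_product i))"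
    by (intro variance_sum_nbhd_le covariance_local_product_far bounded_rv_local_product)
  also have "\<dots> \<le> (2 * real (3 * d) + 1) * ((?D * A)\<^sup>2 * sum_variances)"
    unfolding sum_variances_def sum_distrib_left
    by (intro mult_left_mono sum_mono variance_local_product_le) auto
  also have "\<dots> \<le> (3 * ?D) * ((?D * A)\<^sup>2 * sum_variances)"
    using sum_variances_pos by (intro mult_right_mono) auto
  also have "\<dots> = 3 * (?D * A)\<^sup>2 * (?D * sum_variances) * 1"
    by simp
  also have "\<dots> \<le> 3 * (?D * A)\<^sup>2 * (?D * sum_variances) * (?D * sum_variances)"
    using sum_variances_pos sum_variances_ge by (intro mult_left_mono) auto
  also have "\<dots> = 3 * rate\<^sup>2"
    by (simp add: rate_def power2_eq_square)
  finally show ?thesis .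
qed

lemma expectation_abs_local_product_error_le:
  "expectation (\<lambda>\<omega>. \<bar>1 - (\<Sum>i<N. local_product i \<omega>)\<bar>) \<le> 2 * rate"
proof (rule expectation_abs_le)
  have [simp]: "bounded_rv (\<lambda>\<omega>. \<Sum>i<N. local_product i \<omega>)"
    by (intro bounded_rv_sum) simp
  then show "integrable M (\<lambda>\<omega>. 1 - (\<Sum>i<N. local_product i \<omega>))"
    "integrable M (\<lambda>\<omega>. (1 - (\<Sum>i<N. local_product i \<omega>))\<^sup>2)"
    by simp_all
  have "expectation (\<lambda>\<omega>. (1 - (\<Sum>i<N. local_product i \<omega>))\<^sup>2)
      = variance (\<lambda>\<omega>. \<Sum>i<N. local_product i \<omega>)"
    using sum_expectation_local_product
    by (simp add: Bochner_Integration.integral_sum power2_commute)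
  also have "\<dots> \<le> 3 * rate\<^sup>2"
    by (rule variance_sum_local_product_le)
  also have "\<dots> \<le> (2 * rate)\<^sup>2"
    by (simp add: power_mult_distrib)
  finally show "expectation (\<lambda>\<omega>. (1 - (\<Sum>i<N. local_product i \<omega>))\<^sup>2) \<le> (2 * rate)\<^sup>2" .
qed (use rate_pos in simp)

definition local_weight :: "nat \<Rightarrow> 'a \<Rightarrow> real" where
  "local_weight i \<omega> = \<bar>X i \<omega>\<bar> * (local_sum d i \<omega>)\<^sup>2"

lemma bounded_rv_local_weight [simp]: "i < N \<Longrightarrow> bounded_rv (local_weight i)"
  unfolding local_weight_def [abs_def] by simp

lemma local_weight_nonneg: "0 \<le> local_weight i \<omega>"
  by (simp add: local_weight_def)

lemma expectation_local_weight_le: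
  assumes "i < N"
  shows "expectation (local_weight i)
    \<le> A * (2 * real d + 1) * (\<Sum>j\<in>nbhd d i. expectation (\<lambda>\<omega>. (X j \<omega>)\<^sup>2))"
proof -
  let ?D = "2 * real d + 1"
  have bounded_rv_nbhd: "bounded_rv (X j)" if "j \<in> nbhd d i" for j
    using that nbhd_subset bounded_rv_X by blast
  have "expectation (local_weight i) \<le> expectation (\<lambda>\<omega>. A * (?D * (\<Sum>j\<in>nbhd d i. (X j \<omega>)\<^sup>2)))"
  proof (rule expectation_mono_bounded_rv)
    fix \<omega> assume \<omega>: "\<omega> \<in> space M"
    have "(local_sum d i \<omega>)\<^sup>2 \<le> real (card (nbhd d i)) * (\<Sum>j\<in>nbhd d i. (X j \<omega>)\<^sup>2)"
      using Cauchy_Schwarz_ineq_sum[of "\<lambda>_. 1" "\<lambda>j. X j \<omega>" "nbhd d i"] by (simp add: local_sum_def)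
    also have "\<dots> \<le> ?D * (\<Sum>j\<in>nbhd d i. (X j \<omega>)\<^sup>2)"
      by (intro mult_right_mono card_nbhd_le sum_nonneg) auto
    finally show "local_weight i \<omega> \<le> A * (?D * (\<Sum>j\<in>nbhd d i. (X j \<omega>)\<^sup>2))"
      unfolding local_weight_def using bound_pos \<omega> assms by (intro mult_mono bounded) auto
  qed (use assms bounded_rv_nbhd in auto)
  then show ?thesis
    by (simp add: Bochner_Integration.integral_sum bounded_rv_nbhd mult.assoc)
qed

lemma sum_expectation_local_weight_le: "(\<Sum>i<N. expectation (local_weight i)) \<le> rate"
proof -
  let ?D = "2 * real d + 1"
  have "(\<Sum>i<N. expectation (local_weight i))
      \<le> (\<Sum>i<N. A * ?D * (\<Sum>j\<in>nbhd d i. expectation (\<lambda>\<omega>. (X j \<omega>)\<^sup>2)))"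
    by (intro sum_mono expectation_local_weight_le) auto
  also have "\<dots> = A * ?D * (\<Sum>i<N. \<Sum>j\<in>nbhd d i. expectation (\<lambda>\<omega>. (X j \<omega>)\<^sup>2))"
    by (simp add: sum_distrib_left)
  also have "\<dots> \<le> A * ?D * (?D * sum_variances)"
    unfolding sum_variances_def using bound_pos
    by (intro mult_left_mono sum_nbhd_le Bochner_Integration.integral_nonneg) auto
  finally show ?thesis
    by (simp add: rate_def power2_eq_square mult_ac)
qed

definition cdf_error :: "real \<Rightarrow> real" where
  "cdf_error z = \<bar>cdf (distr M borel W) z - cdf std_normal_distribution z\<bar>"

lemma real_distribution_W: "real_distribution (distr M borel W)"
  by (rule real_distribution_distr) measurable

lemma cdf_error_le_1: "cdf_error z \<le> 1"
proof -
  interpret distribution_W: real_distribution "distr M borel W"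
    by (rule real_distribution_W)
  interpret std_normal: real_distribution std_normal_distribution
    by (rule real_dist_normal_dist)
  show ?thesis
    using distribution_W.cdf_nonneg[of z] distribution_W.cdf_bounded_prob[of z]
      std_normal.cdf_nonneg[of z] std_normal.cdf_bounded_prob[of z]
    unfolding cdf_error_def by linarith
qed

lemma bounded_rv_indicator_W [simp]:
  "S \<in> sets borel \<Longrightarrow> bounded_rv (\<lambda>\<omega>. indicator S (W \<omega>))"
  by (rule bounded_rv_compose[where c = 1]) auto

lemma expectation_indicator_W_le:
  assumes "\<And>x. cdf_error x \<le> \<delta>" "a \<le> b"
  shows "expectation (\<lambda>\<omega>. indicator {a..b} (W \<omega>)) \<le> 2 * \<delta> + (b - a) / 2"
proof -
  have "expectation (\<lambda>\<omega>. indicator {a..b} (W \<omega>)) = (LINT x|distr M borel W. indicat_real {a..b} x)"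
    by (subst integral_distr) auto
  also have "\<dots> = measure (distr M borel W) {a..b}"
    by simp
  also have "\<dots> \<le> 2 * \<delta> + (1 / 2) * (b - a)"
    using assms real_distribution_W cdf_std_normal_diff_le
    by (intro measure_Icc_le_cdf_error[where Q = std_normal_distribution])
      (auto simp: cdf_error_def)
  finally show ?thesis
    by simp
qed

lemma bounded_rv_remainder_weight:
  assumes "bounded_rv Y" "t \<in> borel_measurable M"
  shows "bounded_rv (\<lambda>\<omega>. remainder_weight z \<epsilon> (t \<omega>) (Y \<omega>))"
proof -
  have [measurable]: "Y \<in> borel_measurable M" "t \<in> borel_measurable M"
    using assms borel_measurable_bounded_rv by auto
  have "(\<lambda>\<omega>. indicator {z - t \<omega>..z + \<epsilon> + t \<omega>} (Y \<omega>) :: real) \<in> borel_measurable M"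
    unfolding indicator_def by simp measurable
  then have "bounded_rv (\<lambda>\<omega>. indicator {z - t \<omega>..z + \<epsilon> + t \<omega>} (Y \<omega>))"
    by (rule bounded_rvI[where c = 1]) (auto simp: indicator_def)
  then show ?thesis
    using assms(1) by (simp add: remainder_weight_def)
qed

lemma expectation_remainder_weight_le:
  assumes "\<And>x. cdf_error x \<le> \<delta>" "\<epsilon> > 0" "0 \<le> t"
  shows "expectation (\<lambda>\<omega>. remainder_weight z \<epsilon> t (W \<omega>)) \<le> 5 + (2 * \<delta> + (\<epsilon> + 2 * t) / 2) / \<epsilon>"
proof -
  have "expectation (\<lambda>\<omega>. remainder_weight z \<epsilon> t (W \<omega>)) = 3 + 2 * expectation (\<lambda>\<omega>. \<bar>W \<omega>\<bar>)
      + expectation (\<lambda>\<omega>. indicator {z - t..z + \<epsilon> + t} (W \<omega>)) / \<epsilon>"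
    by (simp add: remainder_weight_def prob_space)
  also have "\<dots> \<le> 3 + 2 * 1 + (2 * \<delta> + ((z + \<epsilon> + t) - (z - t)) / 2) / \<epsilon>"
    using assms
    by (intro add_mono mult_left_mono expectation_abs_W_le divide_right_mono
        expectation_indicator_W_le) auto
  finally show ?thesis
    by (simp add: algebra_simps)
qed

definition far_sum :: "nat \<Rightarrow> 'a \<Rightarrow> real" where
  "far_sum i \<omega> = W \<omega> - local_sum (d + d) i \<omega>"

lemma bounded_rv_far_sum [simp]: "bounded_rv (far_sum i)"
  unfolding far_sum_def [abs_def] by simp

lemma abs_W_minus_far_sum_le: "\<omega> \<in> space M \<Longrightarrow> \<bar>W \<omega> - far_sum i \<omega>\<bar> \<le> 2 * rate"
  using abs_local_sum_le_rate(2) by (simp add: far_sum_def)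

lemma expectation_mult_far_sum:
  assumes "i < N" "g \<in> borel_measurable borel" "bounded_rv (\<lambda>\<omega>. g (far_sum i \<omega>))"
  shows "expectation (\<lambda>\<omega>. local_weight i \<omega> * g (far_sum i \<omega>))
    = expectation (local_weight i) * expectation (\<lambda>\<omega>. g (far_sum i \<omega>))"
proof (rule expectation_mult_far[where r = d and i = i])
  show "local_weight i \<in> borel_measurable (generated_sigma X (nbhd d i))"
    unfolding local_weight_def [abs_def] using \<open>i < N\<close>
    by (intro borel_measurable_times borel_measurable_abs borel_measurable_power
        measurable_local_sum measurable_generated_sigma) (auto simp: nbhd_def)
  show "(\<lambda>\<omega>. g (far_sum i \<omega>)) \<in> borel_measurable (generated_sigma X ({..<N} - nbhd (d + d) i))"
    unfolding far_sum_def using measurable_W_minus_local_sum assms(2) by (rule measurable_compose)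
qed (use assms in simp_all)

text \<open>
  The factor \<open>local_weight i\<close> involves indices within distance \<open>d\<close> of \<open>i\<close>, so it is independent of
  \<open>W\<close> with the indices within distance \<open>2d\<close> removed; the removal shifts \<open>W\<close> by at most
  \<open>2 * rate\<close>, and a second shift returns to \<open>W\<close> itself.
\<close>

lemma expectation_local_remainder_le:
  assumes "\<epsilon> > 0" "i < N"
  shows "expectation (\<lambda>\<omega>. local_weight i \<omega> * remainder_weight z \<epsilon> \<bar>local_sum d i \<omega>\<bar> (W \<omega>))
    \<le> expectation (local_weight i)
       * (expectation (\<lambda>\<omega>. remainder_weight z \<epsilon> (5 * rate) (W \<omega>)) + 8 * rate)"
proof -
  let ?Q = "\<lambda>w. remainder_weight z \<epsilon> (3 * rate) w + 4 * rate"
  have [simp]: "bounded_rv (\<lambda>\<omega>. remainder_weight z \<epsilon> t (Y \<omega>))" if "bounded_rv Y" for Y t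
    using that by (simp add: bounded_rv_remainder_weight)
  have "expectation (\<lambda>\<omega>. local_weight i \<omega> * remainder_weight z \<epsilon> \<bar>local_sum d i \<omega>\<bar> (W \<omega>))
      \<le> expectation (\<lambda>\<omega>. local_weight i \<omega> * ?Q (far_sum i \<omega>))"
  proof (rule expectation_mono_bounded_rv)
    fix \<omega> assume "\<omega> \<in> space M"
    then show "local_weight i \<omega> * remainder_weight z \<epsilon> \<bar>local_sum d i \<omega>\<bar> (W \<omega>)
        \<le> local_weight i \<omega> * ?Q (far_sum i \<omega>)"
      using abs_local_sum_le_rate(1)[of \<omega> i] abs_W_minus_far_sum_le[of \<omega> i]
        remainder_weight_shift[OF \<open>\<epsilon> > 0\<close>, of "W \<omega>" "far_sum i \<omega>" "2 * rate" _ "3 * rate" z]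
      by (intro mult_left_mono local_weight_nonneg) auto
  qed (use \<open>i < N\<close> borel_measurable_bounded_rv in \<open>simp_all add: bounded_rv_remainder_weight\<close>)
  also have "\<dots> = expectation (local_weight i) * expectation (\<lambda>\<omega>. ?Q (far_sum i \<omega>))"
    using \<open>i < N\<close> by (intro expectation_mult_far_sum) simp_all
  also have "\<dots> \<le> expectation (local_weight i)
      * expectation (\<lambda>\<omega>. remainder_weight z \<epsilon> (5 * rate) (W \<omega>) + 8 * rate)"
  proof (intro mult_left_mono expectation_mono_bounded_rv)
    fix \<omega> assume "\<omega> \<in> space M"
    then show "?Q (far_sum i \<omega>) \<le> remainder_weight z \<epsilon> (5 * rate) (W \<omega>) + 8 * rate"
      using remainder_weight_shift[OF \<open>\<epsilon> > 0\<close>, of "far_sum i \<omega>" "W \<omega>" "2 * rate"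
          "3 * rate" "5 * rate" z]
        abs_W_minus_far_sum_le[of \<omega> i] by (simp add: abs_minus_commute)
  qed (simp_all add: local_weight_nonneg)
  finally show ?thesis
    by (simp add: prob_space)
qed

lemma stein_identity:
  assumes "f \<in> borel_measurable borel" "\<And>x. \<bar>f x\<bar> \<le> a"
  shows "expectation (\<lambda>\<omega>. W \<omega> * f (W \<omega>))
    = (\<Sum>i<N. expectation (\<lambda>\<omega>. X i \<omega> * (f (W \<omega>) - f (W \<omega> - local_sum d i \<omega>))))"
proof -
  have [simp]: "bounded_rv (\<lambda>\<omega>. f (Y \<omega>))" if "bounded_rv Y" for Y
    using borel_measurable_bounded_rv[OF that] assms by (rule bounded_rv_compose)
  have "expectation (\<lambda>\<omega>. X i \<omega> * (f (W \<omega>) - f (W \<omega> - local_sum d i \<omega>)))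
      = expectation (\<lambda>\<omega>. X i \<omega> * f (W \<omega>))" if "i < N" for i
    using expectation_X_mult_far[OF that
        measurable_compose[OF measurable_W_minus_local_sum assms(1)]]
      that by (simp add: right_diff_distrib)
  then have "(\<Sum>i<N. expectation (\<lambda>\<omega>. X i \<omega> * (f (W \<omega>) - f (W \<omega> - local_sum d i \<omega>))))
      = expectation (\<lambda>\<omega>. \<Sum>i<N. X i \<omega> * f (W \<omega>))"
    by (simp add: Bochner_Integration.integral_sum)
  also have "\<dots> = expectation (\<lambda>\<omega>. W \<omega> * f (W \<omega>))"
    by (simp only: W_def sum_distrib_right)
  finally show ?thesis ..
qed

lemma stein_error_decomposition:
  assumes f: "f \<in> borel_measurable borel" "\<And>x. \<bar>f x\<bar> \<le> a"
    and f': "f' \<in> borel_measurable borel" "\<And>x. \<bar>f' x\<bar> \<le> b"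
  shows "expectation (\<lambda>\<omega>. f' (W \<omega>) - W \<omega> * f (W \<omega>))
    = expectation (\<lambda>\<omega>. f' (W \<omega>) * (1 - (\<Sum>i<N. local_product i \<omega>)))
      + (\<Sum>i<N. expectation (\<lambda>\<omega>. X i \<omega> *
           (local_sum d i \<omega> * f' (W \<omega>) - (f (W \<omega>) - f (W \<omega> - local_sum d i \<omega>)))))"
proof -
  have [simp]: "bounded_rv (\<lambda>\<omega>. f (Y \<omega>))" "bounded_rv (\<lambda>\<omega>. f' (Y \<omega>))" if "bounded_rv Y" for Y
    using borel_measurable_bounded_rv[OF that] f f' by (blast intro: bounded_rv_compose)+
  have [simp]: "bounded_rv (\<lambda>\<omega>. \<Sum>i<N. local_product i \<omega> * f' (W \<omega>))"
    by (intro bounded_rv_sum) simp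
  have "f' w * (1 - (\<Sum>i<N. local_product i \<omega>)) = f' w - (\<Sum>i<N. local_product i \<omega> * f' w)" for w \<omega>
    by (simp add: right_diff_distrib sum_distrib_left mult.commute)
  then have "expectation (\<lambda>\<omega>. f' (W \<omega>) - W \<omega> * f (W \<omega>))
      = expectation (\<lambda>\<omega>. f' (W \<omega>) * (1 - (\<Sum>i<N. local_product i \<omega>)))
        + (expectation (\<lambda>\<omega>. \<Sum>i<N. local_product i \<omega> * f' (W \<omega>))
           - expectation (\<lambda>\<omega>. W \<omega> * f (W \<omega>)))"
    by simp
  also have "expectation (\<lambda>\<omega>. \<Sum>i<N. local_product i \<omega> * f' (W \<omega>))
        - expectation (\<lambda>\<omega>. W \<omega> * f (W \<omega>))
      = (\<Sum>i<N. expectation (\<lambda>\<omega>. X i \<omega> *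
           (local_sum d i \<omega> * f' (W \<omega>) - (f (W \<omega>) - f (W \<omega> - local_sum d i \<omega>)))))"
    unfolding stein_identity[OF f]
    by (simp add: Bochner_Integration.integral_sum sum_subtractf[symmetric] local_product_def
        right_diff_distrib mult.assoc)
  finally show ?thesis .
qed

lemma abs_quadratic_error_le:
  assumes "f' \<in> borel_measurable borel" "\<And>x. \<bar>f' x\<bar> \<le> b"
  shows "\<bar>expectation (\<lambda>\<omega>. f' (W \<omega>) * (1 - (\<Sum>i<N. local_product i \<omega>)))\<bar> \<le> b * (2 * rate)"
proof -
  let ?S = "\<lambda>\<omega>. 1 - (\<Sum>i<N. local_product i \<omega>)"
  have [simp]: "bounded_rv (\<lambda>\<omega>. f' (W \<omega>))"
    using borel_measurable_W assms by (rule bounded_rv_compose)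
  have [simp]: "bounded_rv ?S"
    by (intro bounded_rv_diff bounded_rv_sum) simp_all
  have "0 \<le> b"
    using abs_ge_zero assms(2) by (rule order_trans)
  have "\<bar>expectation (\<lambda>\<omega>. f' (W \<omega>) * ?S \<omega>)\<bar> \<le> expectation (\<lambda>\<omega>. \<bar>f' (W \<omega>) * ?S \<omega>\<bar>)"
    by (rule integral_abs_bound)
  also have "\<dots> \<le> expectation (\<lambda>\<omega>. b * \<bar>?S \<omega>\<bar>)"
    unfolding abs_mult
    by (intro expectation_mono_bounded_rv mult_right_mono assms bounded_rv_mult bounded_rv_abs)
      simp_all
  also have "\<dots> \<le> b * (2 * rate)"
    using expectation_abs_local_product_error_le \<open>0 \<le> b\<close> by (simp add: mult_left_mono)
  finally show ?thesis .
qed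

definition stein_remainder :: "real \<Rightarrow> real \<Rightarrow> nat \<Rightarrow> 'a \<Rightarrow> real" where
  "stein_remainder z \<epsilon> i \<omega> = local_sum d i \<omega> * stein_derivative (ramp z \<epsilon>) (W \<omega>)
     - (stein_solution (ramp z \<epsilon>) (W \<omega>) - stein_solution (ramp z \<epsilon>) (W \<omega> - local_sum d i \<omega>))"

lemma bounded_rv_stein_ramp [simp]:
  assumes "bounded_rv Y"
  shows "bounded_rv (\<lambda>\<omega>. stein_solution (ramp z \<epsilon>) (Y \<omega>))"
    and "bounded_rv (\<lambda>\<omega>. stein_derivative (ramp z \<epsilon>) (Y \<omega>))"
  using bounded_rv_compose[OF borel_measurable_bounded_rv[OF assms]]
    borel_measurable_stein_solution_ramp abs_stein_solution_ramp_le
    borel_measurable_stein_derivative_ramp abs_stein_derivative_ramp_le by blast+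

lemma abs_expectation_stein_remainder_le:
  assumes "i < N" "\<epsilon> > 0"
  shows "\<bar>expectation (\<lambda>\<omega>. X i \<omega> * stein_remainder z \<epsilon> i \<omega>)\<bar>
    \<le> expectation (\<lambda>\<omega>. local_weight i \<omega> * remainder_weight z \<epsilon> \<bar>local_sum d i \<omega>\<bar> (W \<omega>))"
proof -
  have "\<bar>expectation (\<lambda>\<omega>. X i \<omega> * stein_remainder z \<epsilon> i \<omega>)\<bar>
      \<le> expectation (\<lambda>\<omega>. \<bar>X i \<omega> * stein_remainder z \<epsilon> i \<omega>\<bar>)"
    by (rule integral_abs_bound)
  also have "\<dots> \<le> expectation
      (\<lambda>\<omega>. local_weight i \<omega> * remainder_weight z \<epsilon> \<bar>local_sum d i \<omega>\<bar> (W \<omega>))"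
  proof (rule expectation_mono_bounded_rv)
    show "\<bar>X i \<omega> * stein_remainder z \<epsilon> i \<omega>\<bar>
        \<le> local_weight i \<omega> * remainder_weight z \<epsilon> \<bar>local_sum d i \<omega>\<bar> (W \<omega>)" for \<omega>
      unfolding abs_mult local_weight_def mult.assoc stein_remainder_def
      by (intro mult_left_mono stein_remainder_le \<open>\<epsilon> > 0\<close>) simp
    show "bounded_rv (\<lambda>\<omega>. \<bar>X i \<omega> * stein_remainder z \<epsilon> i \<omega>\<bar>)"
      using \<open>i < N\<close> by (simp add: stein_remainder_def [abs_def])
  qed (use \<open>i < N\<close> borel_measurable_bounded_rv in \<open>simp add: bounded_rv_remainder_weight\<close>)
  finally show ?thesis .
qed

lemma abs_sum_stein_remainder_le:
  assumes "\<epsilon> > 0"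
  shows "\<bar>\<Sum>i<N. expectation (\<lambda>\<omega>. X i \<omega> * stein_remainder z \<epsilon> i \<omega>)\<bar>
    \<le> rate * (expectation (\<lambda>\<omega>. remainder_weight z \<epsilon> (5 * rate) (W \<omega>)) + 8 * rate)"
    (is "_ \<le> rate * ?K")
proof -
  have "\<bar>\<Sum>i<N. expectation (\<lambda>\<omega>. X i \<omega> * stein_remainder z \<epsilon> i \<omega>)\<bar>
      \<le> (\<Sum>i<N. \<bar>expectation (\<lambda>\<omega>. X i \<omega> * stein_remainder z \<epsilon> i \<omega>)\<bar>)"
    by (rule sum_abs)
  also have "\<dots> \<le> (\<Sum>i<N. expectation (local_weight i) * ?K)"
    using \<open>\<epsilon> > 0\<close> order_trans[OF abs_expectation_stein_remainder_le expectation_local_remainder_le]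
    by (intro sum_mono) simp
  also have "\<dots> \<le> rate * ?K"
    unfolding sum_distrib_right[symmetric] using rate_pos \<open>\<epsilon> > 0\<close>
    by (intro mult_right_mono sum_expectation_local_weight_le add_nonneg_nonneg
        Bochner_Integration.integral_nonneg) (auto simp: remainder_weight_def)
  finally show ?thesis .
qed

lemma expectation_ramp_diff_eq:
  "expectation (\<lambda>\<omega>. ramp z \<epsilon> (W \<omega>)) - (LINT t|std_normal_distribution. ramp z \<epsilon> t)
    = expectation (\<lambda>\<omega>. stein_derivative (ramp z \<epsilon>) (W \<omega>) * (1 - (\<Sum>i<N. local_product i \<omega>)))
      + (\<Sum>i<N. expectation (\<lambda>\<omega>. X i \<omega> * stein_remainder z \<epsilon> i \<omega>))"
proof -
  let ?f = "stein_solution (ramp z \<epsilon>)" and ?f' = "stein_derivative (ramp z \<epsilon>)"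
  have [simp]: "bounded_rv (\<lambda>\<omega>. ramp z \<epsilon> (W \<omega>))"
    using ramp_bounds by (intro bounded_rv_compose[where c = 1]) auto
  have "?f' w - w * ?f w = ramp z \<epsilon> w - (LINT t|std_normal_distribution. ramp z \<epsilon> t)" for w
    by (simp add: stein_derivative_def std_normal_centred_def)
  then have "expectation (\<lambda>\<omega>. ramp z \<epsilon> (W \<omega>)) - (LINT t|std_normal_distribution. ramp z \<epsilon> t)
      = expectation (\<lambda>\<omega>. ?f' (W \<omega>) - W \<omega> * ?f (W \<omega>))"
    by (simp add: prob_space)
  then show ?thesis
    unfolding stein_remainder_def
    using stein_error_decomposition[OF borel_measurable_stein_solution_ramp
        abs_stein_solution_ramp_le borel_measurable_stein_derivative_ramp
        abs_stein_derivative_ramp_le] by simp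
qed

text \<open>
  The width \<open>4 * rate\<close> makes the coefficient of \<open>\<delta>\<close> equal to \<open>1/2\<close>, so that the supremum of
  \<open>cdf_error\<close> can be absorbed into the left-hand side.
\<close>

lemma abs_expectation_ramp_diff_le:
  assumes "\<And>x. cdf_error x \<le> \<delta>" "rate \<le> 1 / 28"
  shows "\<bar>expectation (\<lambda>\<omega>. ramp z (4 * rate) (W \<omega>))
      - (LINT t|std_normal_distribution. ramp z (4 * rate) t)\<bar> \<le> 12 * rate + \<delta> / 2"
proof -
  have "\<bar>expectation (\<lambda>\<omega>. ramp z (4 * rate) (W \<omega>))
      - (LINT t|std_normal_distribution. ramp z (4 * rate) t)\<bar>
    \<le> 2 * (2 * rate)
      + rate * (expectation (\<lambda>\<omega>. remainder_weight z (4 * rate) (5 * rate) (W \<omega>)) + 8 * rate)"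
    unfolding expectation_ramp_diff_eq using rate_pos
    by (intro order_trans[OF abs_triangle_ineq] add_mono abs_quadratic_error_le
        abs_sum_stein_remainder_le abs_stein_derivative_ramp_le
        borel_measurable_stein_derivative_ramp) simp
  also have "\<dots> \<le> 2 * (2 * rate)
      + rate * (5 + (2 * \<delta> + (4 * rate + 2 * (5 * rate)) / 2) / (4 * rate) + 8 * rate)"
    using assms rate_pos
    by (intro add_mono mult_left_mono expectation_remainder_weight_le) auto
  also have "\<dots> = 43 / 4 * rate + \<delta> / 2 + 8 * rate * rate"
    using rate_pos by (simp add: field_simps)
  also have "\<dots> \<le> 43 / 4 * rate + \<delta> / 2 + 8 * rate * (1 / 28)"
    using assms rate_pos by (intro add_mono mult_left_mono) auto
  also have "\<dots> \<le> 12 * rate + \<delta> / 2"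
    using rate_pos by simp
  finally show ?thesis .
qed

lemma cdf_error_bootstrap:
  assumes "\<And>x. cdf_error x \<le> \<delta>" "rate \<le> 1 / 28"
  shows "cdf_error z \<le> 14 * rate + \<delta> / 2"
proof -
  have "cdf_error z \<le> (12 * rate + \<delta> / 2) + (1 / 2) * (4 * rate)"
    unfolding cdf_error_def
  proof (rule abs_cdf_diff_le_ramp[OF real_distribution_W real_dist_normal_dist])
    show "\<bar>(LINT t|distr M borel W. ramp y (4 * rate) t)
        - (LINT t|std_normal_distribution. ramp y (4 * rate) t)\<bar> \<le> 12 * rate + \<delta> / 2" for y
      using abs_expectation_ramp_diff_le[OF assms, of y] by (subst integral_distr) auto
  qed (use rate_pos cdf_std_normal_diff_le in auto)
  then show ?thesis
    by simp
qed

lemma cdf_error_le_rate: "cdf_error z \<le> 28 * rate"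
proof (cases "rate \<le> 1 / 28")
  case True
  have bdd: "bdd_above (range cdf_error)"
    using cdf_error_le_1 by (intro bdd_aboveI[of _ 1]) auto
  define \<delta> where "\<delta> = (SUP x. cdf_error x)"
  have upper: "cdf_error x \<le> \<delta>" for x
    unfolding \<delta>_def by (rule cSUP_upper[OF _ bdd]) simp
  have "(SUP x. cdf_error x) \<le> 14 * rate + \<delta> / 2"
    using cdf_error_bootstrap[OF upper True] by (intro cSUP_least) auto
  then show ?thesis
    using upper[of z] unfolding \<delta>_def by linarith
next
  case False
  then show ?thesis
    using cdf_error_le_1[of z] by linarith
qed

end

theorem (in prob_space) m_dependent_berry_esseen:
  assumes dependence: "m_dependent d N X"
    and bounded: "\<And>i \<omega>. i < N \<Longrightarrow> \<omega> \<in> space M \<Longrightarrow> \<bar>X i \<omega> - expectation (X i)\<bar> \<le> A"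
    and variance: "variance (\<lambda>\<omega>. \<Sum>i<N. X i \<omega>) = b\<^sup>2" and "b > 0"
  shows "\<bar>prob {\<omega> \<in> space M. (\<Sum>i<N. X i \<omega>) \<le> x}
      - cdf std_normal_distribution ((x - (\<Sum>i<N. expectation (X i))) / b)\<bar>
    \<le> 28 * ((2 * real d + 1)\<^sup>2 * A * (\<Sum>i<N. variance (X i)) / b ^ 3)"
proof -
  define Y where "Y i \<omega> = (X i \<omega> - expectation (X i)) / b" for i \<omega>
  have bounded_rv_X: "bounded_rv (X i)" if "i < N" for i
    using borel_measurable_m_dependent[OF dependence that] bounded[OF that]
    by (rule bounded_rv_if_abs_diff_le)
  have sum_Y: "(\<Sum>i<N. Y i \<omega>) = ((\<Sum>i<N. X i \<omega>) - (\<Sum>i<N. expectation (X i))) / b" for \<omega>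
    by (simp add: Y_def sum_divide_distrib[symmetric] sum_subtractf)
  have expectation_sum_X: "expectation (\<lambda>\<omega>. \<Sum>i<N. X i \<omega>) = (\<Sum>i<N. expectation (X i))"
    using bounded_rv_X by (simp add: Bochner_Integration.integral_sum)
  have bounded_rv_sum_X: "bounded_rv (\<lambda>\<omega>. \<Sum>i<N. X i \<omega>)"
    using bounded_rv_X by (intro bounded_rv_sum) simp
  interpret m_dependent_sum M Y N d "A / b"
  proof
    show "m_dependent d N Y"
      unfolding Y_def [abs_def] using dependence by (rule m_dependent_compose) measurable
    show "expectation (Y i) = 0" if "i < N" for i
      using bounded_rv_X[OF that] by (simp add: Y_def [abs_def] prob_space)
    show "\<bar>Y i \<omega>\<bar> \<le> A / b" if "i < N" "\<omega> \<in> space M" for i \<omega>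
      using bounded[OF that] \<open>b > 0\<close> by (simp add: Y_def abs_divide divide_right_mono)
    show "variance (\<lambda>\<omega>. \<Sum>i<N. Y i \<omega>) = 1"
      using variance \<open>b > 0\<close> bounded_rv_sum_X
      by (simp add: sum_Y expectation_sum_X prob_space power_divide)
  qed
  have rate_eq: "rate = (2 * real d + 1)\<^sup>2 * A * (\<Sum>i<N. variance (X i)) / b ^ 3"
    by (simp add: rate_def sum_variances_def Y_def power_divide sum_divide_distrib[symmetric]
        power2_eq_square power3_eq_cube)
  let ?z = "(x - (\<Sum>i<N. expectation (X i))) / b"
  have "cdf (distr M borel W) ?z = prob {\<omega> \<in> space M. (\<Sum>i<N. X i \<omega>) \<le> x}"
    using \<open>b > 0\<close>
    by (simp add: cdf_def measure_distr vimage_def Int_def W_def sum_Y divide_le_cancel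
        conj_commute)
  then show ?thesis
    using cdf_error_le_rate[of ?z] by (simp add: cdf_error_def rate_eq)
qed

section \<open>Cutting a Mallows permutation\<close>

lemma strict_mono_on_rank:
  fixes A :: "nat set"
  assumes "finite A"
  shows "strict_mono_on A (\<lambda>x. card {y \<in> A. y \<le> x})"
proof (rule strict_mono_onI)
  fix x z assume "x \<in> A" "z \<in> A" "x < z"
  then have "z \<in> {y \<in> A. y \<le> z}" "z \<notin> {y \<in> A. y \<le> x}" "{y \<in> A. y \<le> x} \<subseteq> {y \<in> A. y \<le> z}"
    by auto
  then have "{y \<in> A. y \<le> x} \<subset> {y \<in> A. y \<le> z}"
    by blast
  then show "card {y \<in> A. y \<le> x} < card {y \<in> A. y \<le> z}"
    using assms by (intro psubset_card_mono) auto
qed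

lemma st_map:
  assumes "strict_mono_on (set w) r"
  shows "st (map r w) = st w"
proof -
  have "card {y \<in> set (map r w). y \<le> r x} = card {y \<in> set w. y \<le> x}" if "x \<in> set w" for x
  proof -
    have "{y \<in> set (map r w). y \<le> r x} = r ` {y \<in> set w. y \<le> x}"
      using that strict_mono_on_less_eq[OF assms] by auto
    moreover have "inj_on r {y \<in> set w. y \<le> x}"
      using strict_mono_on_imp_inj_on[OF assms] by (rule inj_on_subset) auto
    ultimately show ?thesis
      by (simp add: card_image)
  qed
  then show ?thesis
    by (simp add: st_def)
qed

lemma factor_map: "factor j k (map f w) = map f (factor j k w)"
  by (simp add: factor_def take_map drop_map)

lemma set_factor_subset: "set (factor j k w) \<subseteq> set w"
  unfolding factor_def using set_take_subset set_drop_subset by (rule subset_trans)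

lemma distinct_factor: "distinct w \<Longrightarrow> distinct (factor j k w)"
  by (simp add: factor_def)

lemma length_factor: "length (factor j k w) = min k (length w - j)"
  by (simp add: factor_def)

lemma factor_factor: "i + k \<le> l \<Longrightarrow> factor i k (factor j l w) = factor (j + i) k w"
  by (simp add: factor_def drop_take min_def add.commute)

lemma st_factor_st: "st (factor j k (st w)) = st (factor j k w)"
proof -
  have "strict_mono_on (set (factor j k w)) (\<lambda>x. card {y \<in> set w. y \<le> x})"
    using strict_mono_on_rank set_factor_subset by (rule monotone_on_subset) simp
  then show ?thesis
    unfolding st_def[of w] factor_map by (rule st_map)
qed

lemma st_eq_imp_eq:
  assumes "set u = set v" "st u = st v"
  shows "u = v"
proof -
  let ?r = "\<lambda>x. card {y \<in> set v. y \<le> x}"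
  have "inj_on ?r (set u \<union> set v)"
    using assms(1) strict_mono_on_imp_inj_on[OF strict_mono_on_rank, of "set v"] by simp
  moreover have "map ?r u = map ?r v"
    using assms by (simp add: st_def)
  ultimately show ?thesis
    by (simp add: inj_on_map_eq_map)
qed

lemma length_st [simp]: "length (st w) = length w"
  by (simp add: st_def)

lemma inversions_st: "inversions (st w) = inversions w"
proof -
  have "{(i, j). i < j \<and> j < length (st w) \<and> st w ! i > st w ! j}
      = {(i, j). i < j \<and> j < length w \<and> w ! i > w ! j}"
    by (auto simp: st_order_iso)
  then show ?thesis
    by (simp add: inversions_def)
qed

definition cross_inversions :: "nat set \<Rightarrow> nat set \<Rightarrow> nat" where
  "cross_inversions A B = card {(x, y). x \<in> A \<and> y \<in> B \<and> y < x}"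

lemma cross_inversions_insert:
  assumes "finite A" "finite B" "x \<notin> A"
  shows "cross_inversions (insert x A) B = card {y \<in> B. y < x} + cross_inversions A B"
proof -
  have "finite {(z, y). z \<in> A \<and> y \<in> B \<and> y < z}"
    using assms(1,2) by (rule finite_subset[OF _ finite_cartesian_product, rotated]) auto
  have "cross_inversions (insert x A) B
      = card (Pair x ` {y \<in> B. y < x} \<union> {(z, y). z \<in> A \<and> y \<in> B \<and> y < z})"
    unfolding cross_inversions_def by (rule arg_cong[where f = card]) auto
  also have "\<dots> = card (Pair x ` {y \<in> B. y < x}) + cross_inversions A B"
    unfolding cross_inversions_def using assms \<open>finite {(z, y). z \<in> A \<and> y \<in> B \<and> y < z}\<close>
    by (intro card_Un_disjoint) auto
  also have "card (Pair x ` {y \<in> B. y < x}) = card {y \<in> B. y < x}"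
    by (intro card_image) (simp add: inj_on_def)
  finally show ?thesis .
qed

lemma inversions_append:
  assumes "distinct (u @ v)"
  shows "inversions (u @ v) = inversions u + inversions v + cross_inversions (set u) (set v)"
  using assms
proof (induction u)
  case Nil
  then show ?case
    by (simp add: cross_inversions_def)
next
  case (Cons x u)
  have "{y \<in> set (u @ v). y < x} = {y \<in> set u. y < x} \<union> {y \<in> set v. y < x}"
    by auto
  then have "card {y \<in> set (u @ v). y < x} = card {y \<in> set u. y < x} + card {y \<in> set v. y < x}"
    using Cons.prems by (subst card_Un_disjoint[symmetric]) auto
  moreover have "inversions (x # u @ v) = card {y \<in> set (u @ v). y < x} + inversions (u @ v)"
    "inversions (x # u) = card {y \<in> set u. y < x} + inversions u"
    using Cons.prems by (intro inversions_Cons; simp)+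
  ultimately show ?case
    using Cons by (simp add: cross_inversions_insert)
qed

lemma length_Sym: "w \<in> Sym n \<Longrightarrow> length w = n"
  by (simp add: length_finite_permutations_of_set)

lemma set_drop_Sym: "w \<in> Sym n \<Longrightarrow> set (drop a w) = {1..n} - set (take a w)"
  using permutations_of_setD[of w "{1..n}"] set_append[of "take a w" "drop a w"]
    distinct_append[of "take a w" "drop a w"] by auto

lemma inversions_cut_Sym:
  assumes "w \<in> Sym n"
  shows "inversions w = inversions (st (take a w)) + inversions (st (drop a w))
    + cross_inversions (set (take a w)) ({1..n} - set (take a w))"
  using inversions_append[of "take a w" "drop a w"] permutations_of_setD[OF assms]
  by (simp add: inversions_st set_drop_Sym[OF assms])

lemma inj_on_cut_Sym:
  "inj_on (\<lambda>w. ((st (take a w), st (drop a w)), set (take a w))) (Sym n)"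
proof (rule inj_onI)
  fix v w assume "v \<in> Sym n" "w \<in> Sym n"
    and "((st (take a v), st (drop a v)), set (take a v))
      = ((st (take a w), st (drop a w)), set (take a w))"
  then have "take a v = take a w" "drop a v = drop a w"
    by (auto simp: set_drop_Sym intro!: st_eq_imp_eq)
  then show "v = w"
    by (metis append_take_drop_id)
qed

lemma bij_betw_cut_Sym:
  "bij_betw (\<lambda>w. ((st (take a w), st (drop a w)), set (take a w))) (Sym (a + b))
     ((Sym a \<times> Sym b) \<times> {B. B \<subseteq> {1..a + b} \<and> card B = a})"
  (is "bij_betw ?F ?S ?T")
proof -
  have "?F ` ?S \<subseteq> ?T"
  proof (rule image_subsetI)
    fix w assume w: "w \<in> ?S"
    have "st (take a w) \<in> Sym a" "st (drop a w) \<in> Sym b"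
      using st_in_Sym[of "take a w"] st_in_Sym[of "drop a w"] permutations_of_setD[OF w]
        length_Sym[OF w] by simp_all
    moreover have "set (take a w) \<subseteq> {1..a + b}" "card (set (take a w)) = a"
      using permutations_of_setD[OF w] set_take_subset[of a w] length_Sym[OF w]
      by (auto simp: distinct_card)
    ultimately show "?F w \<in> ?T"
      by blast
  qed
  moreover have "finite {B. B \<subseteq> {1..a + b} \<and> card B = a}"
    by (rule finite_subset[of _ "Pow {1..a + b}"]) auto
  moreover have "card ?T = card ?S"
    using binomial_fact_lemma[of a "a + b"] n_subsets[of "{1..a + b}" a]
    by (simp add: card_cartesian_product mult.assoc)
  ultimately have "?F ` ?S = ?T"
    using inj_on_cut_Sym by (intro card_subset_eq) (auto simp: card_image)
  then show ?thesis
    using inj_on_cut_Sym by (simp add: bij_betw_def)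
qed

lemma bij_betw_fibre:
  assumes "bij_betw (\<lambda>x. (f x, g x)) S (A \<times> B)" "a \<in> A"
  shows "bij_betw g {x \<in> S. f x = a} B"
proof (rule bij_betw_imageI)
  show "inj_on g {x \<in> S. f x = a}"
    using bij_betw_imp_inj_on[OF assms(1)] by (auto simp: inj_on_def)
  have image: "(\<lambda>x. (f x, g x)) ` S = A \<times> B"
    using assms(1) by (rule bij_betw_imp_surj_on)
  show "g ` {x \<in> S. f x = a} = B"
  proof (intro equalityI subsetI)
    fix y assume "y \<in> g ` {x \<in> S. f x = a}"
    then show "y \<in> B"
      using image by blast
  next
    fix y assume "y \<in> B"
    then have "(a, y) \<in> (\<lambda>x. (f x, g x)) ` S"
      unfolding image using assms(2) by blast
    then show "y \<in> g ` {x \<in> S. f x = a}"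
      by auto
  qed
qed

lemma pmf_map_finite:
  assumes "finite (set_pmf p)"
  shows "pmf (map_pmf f p) y = (\<Sum>x\<in>{x \<in> set_pmf p. f x = y}. pmf p x)"
proof -
  have "pmf (map_pmf f p) y = measure_pmf.prob p (f -` {y} \<inter> set_pmf p)"
    by (simp add: pmf_map measure_Int_set_pmf)
  also have "f -` {y} \<inter> set_pmf p = {x \<in> set_pmf p. f x = y}"
    by auto
  finally show ?thesis
    using assms by (simp add: measure_measure_pmf_finite)
qed

lemma pmf_eq_of_proportional:
  assumes proportional: "\<And>x. pmf P x = c * pmf Q x"
  shows "P = Q"
proof -
  have "1 = (\<integral>x. pmf P x \<partial>count_space UNIV)"
    by (simp add: integral_pmf)
  also have "\<dots> = c * (\<integral>x. pmf Q x \<partial>count_space UNIV)"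
    by (simp add: proportional)
  also have "\<dots> = c"
    by (simp add: integral_pmf)
  finally show ?thesis
    by (intro pmf_eqI) (simp add: proportional)
qed

lemma set_mallows: "q > 0 \<Longrightarrow> set_pmf (mallows n q) = Sym n"
  using qfact_pos[of q n] by (auto simp: set_pmf_eq pmf_mallows)

lemma pmf_cut_mallows:
  assumes "q > 0" "u \<in> Sym a" "v \<in> Sym b"
  shows "pmf (map_pmf (\<lambda>w. (st (take a w), st (drop a w))) (mallows (a + b) q)) (u, v)
    = q ^ inversions u * q ^ inversions v *
       ((\<Sum>B | B \<subseteq> {1..a + b} \<and> card B = a. q ^ cross_inversions B ({1..a + b} - B))
          / qfact q (a + b))"
proof -
  let ?n = "a + b"
  let ?cut = "\<lambda>w. (st (take a w), st (drop a w))"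
  let ?c = "\<lambda>B. q ^ cross_inversions B ({1..?n} - B)"
  let ?I = "inversions u + inversions v"
  have "pmf (map_pmf ?cut (mallows ?n q)) (u, v)
      = (\<Sum>w\<in>{w \<in> Sym ?n. ?cut w = (u, v)}. pmf (mallows ?n q) w)"
    using assms(1) by (subst pmf_map_finite) (simp_all add: set_mallows)
  also have "\<dots> = (\<Sum>w\<in>{w \<in> Sym ?n. ?cut w = (u, v)}. q ^ ?I * ?c (set (take a w)) / qfact q ?n)"
    using assms(1)
    by (intro sum.cong) (auto simp: pmf_mallows inversions_cut_Sym[where a = a] power_add)
  also have "\<dots> = (\<Sum>B | B \<subseteq> {1..?n} \<and> card B = a. q ^ ?I * ?c B / qfact q ?n)"
    using assms(2,3) by (intro sum.reindex_bij_betw bij_betw_fibre[OF bij_betw_cut_Sym]) auto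
  finally show ?thesis
    by (simp add: power_add sum_distrib_left[symmetric] sum_divide_distrib[symmetric])
qed

theorem map_pmf_cut_mallows:
  assumes "q > 0"
  shows "map_pmf (\<lambda>w. (st (take a w), st (drop a w))) (mallows (a + b) q)
    = pair_pmf (mallows a q) (mallows b q)"
proof -
  let ?n = "a + b"
  let ?cut = "\<lambda>w. (st (take a w), st (drop a w))"
  let ?S = "\<Sum>B | B \<subseteq> {1..?n} \<and> card B = a. q ^ cross_inversions B ({1..?n} - B)"
  have "pmf (map_pmf ?cut (mallows ?n q)) (u, v)
      = ?S / qfact q ?n * qfact q a * qfact q b * pmf (pair_pmf (mallows a q) (mallows b q)) (u, v)"
    for u v
  proof (cases "u \<in> Sym a \<and> v \<in> Sym b")
    case True
    then show ?thesis
      using assms qfact_pos[OF assms, of a] qfact_pos[OF assms, of b]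
      by (simp add: pmf_cut_mallows pmf_pair pmf_mallows)
  next
    case False
    then have "(u, v) \<notin> ?cut ` set_pmf (mallows ?n q)"
      using bij_betw_imp_surj_on[OF bij_betw_cut_Sym, of a b] assms by (auto simp: set_mallows)
    then have "pmf (map_pmf ?cut (mallows ?n q)) (u, v) = 0"
      by (rule pmf_map_outside)
    then show ?thesis
      using False assms by (auto simp: pmf_pair pmf_mallows)
  qed
  then show ?thesis
    by (intro pmf_eq_of_proportional[where c = "?S / qfact q ?n * qfact q a * qfact q b"]) auto
qed

lemma map_pmf_st_take_mallows:
  "q > 0 \<Longrightarrow> a \<le> n \<Longrightarrow> map_pmf (\<lambda>w. st (take a w)) (mallows n q) = mallows a q"
  using arg_cong[OF map_pmf_cut_mallows[of q a "n - a"], of "map_pmf fst"]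
  by (simp add: map_pmf_comp map_fst_pair_pmf)

lemma map_pmf_st_drop_mallows:
  "q > 0 \<Longrightarrow> a \<le> n \<Longrightarrow> map_pmf (\<lambda>w. st (drop a w)) (mallows n q) = mallows (n - a) q"
  using arg_cong[OF map_pmf_cut_mallows[of q a "n - a"], of "map_pmf snd"]
  by (simp add: map_pmf_comp map_snd_pair_pmf)

lemma map_pmf_st_factor_mallows:
  assumes "q > 0" "j + k \<le> n"
  shows "map_pmf (\<lambda>w. st (factor j k w)) (mallows n q) = mallows k q"
proof -
  have "st (factor j k w) = st (take k (st (drop j w)))" for w
    using st_factor_st[of 0 k "drop j w"] by (simp add: factor_def)
  then have "map_pmf (\<lambda>w. st (factor j k w)) (mallows n q)
      = map_pmf (\<lambda>w. st (take k w)) (map_pmf (\<lambda>w. st (drop j w)) (mallows n q))"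
    by (simp add: map_pmf_comp)
  then show ?thesis
    using assms by (simp add: map_pmf_st_take_mallows map_pmf_st_drop_mallows)
qed

lemma prob_st_factor_mallows:
  assumes "q > 0" "j + k \<le> n"
  shows "measure_pmf.prob (mallows n q) {w. st (factor j k w) \<in> A}
    = measure_pmf.prob (mallows k q) A"
proof -
  have "measure_pmf.prob (map_pmf (\<lambda>w. st (factor j k w)) (mallows n q)) A
      = measure_pmf.prob (mallows n q) {w. st (factor j k w) \<in> A}"
    by (simp add: vimage_def)
  then show ?thesis
    by (simp add: map_pmf_st_factor_mallows[OF assms])
qed

lemma indep_var_if_map_pmf_eq_pair_pmf:
  assumes "map_pmf (\<lambda>\<omega>. (U \<omega>, V \<omega>)) M = pair_pmf P Q"
  shows "prob_space.indep_var (measure_pmf M) (count_space UNIV) U (count_space UNIV) V"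
proof (rule measure_pmf.indep_varI)
  fix A B
  have marginals: "map_pmf U M = P" "map_pmf V M = Q"
    using arg_cong[OF assms, of "map_pmf fst"] arg_cong[OF assms, of "map_pmf snd"]
    by (simp_all add: map_pmf_comp map_fst_pair_pmf map_snd_pair_pmf)
  have "(U -` A \<inter> space M) \<inter> (V -` B \<inter> space M) = (\<lambda>\<omega>. (U \<omega>, V \<omega>)) -` (A \<times> B)"
    by auto
  then have "measure_pmf.prob M ((U -` A \<inter> space M) \<inter> (V -` B \<inter> space M))
      = measure_pmf.prob (pair_pmf P Q) (A \<times> B)"
    unfolding assms[symmetric] by simp
  also have "emeasure (pair_pmf P Q) (A \<times> B) = emeasure P A * emeasure Q B"
    by (simp add: nn_integral_indicator[symmetric] nn_integral_pair_pmf' indicator_times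
        nn_integral_cmult nn_integral_multc del: nn_integral_indicator)
  then have "measure_pmf.prob (pair_pmf P Q) (A \<times> B) = measure_pmf.prob P A * measure_pmf.prob Q B"
    by (simp add: measure_def enn2real_mult)
  finally show "measure_pmf.prob M ((U -` A \<inter> space M) \<inter> (V -` B \<inter> space M))
      = measure_pmf.prob M (U -` A \<inter> space M) * measure_pmf.prob M (V -` B \<inter> space M)"
    unfolding marginals[symmetric] by simp
qed simp_all

lemma indep_var_cut_mallows:
  assumes "q > 0" "c \<le> n"
  shows "prob_space.indep_var (mallows n q)
    (count_space UNIV) (\<lambda>w. st (take c w)) (count_space UNIV) (\<lambda>w. st (drop c w))"
  using map_pmf_cut_mallows[OF assms(1), of c "n - c"] assms(2)
  by (intro indep_var_if_map_pmf_eq_pair_pmf) simp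

lemma borel_measurable_vimage_algebra_count_space:
  "(\<lambda>\<omega>. g (U \<omega>)) \<in> borel_measurable (vimage_algebra \<Omega> U (count_space UNIV))"
  by (rule measurable_compose[OF measurable_vimage_algebra1]) auto

lemma m_dependent_mallows_factors:
  fixes h :: "nat list \<Rightarrow> real"
  assumes "q > 0" "m \<ge> 1" "N + m \<le> n + 1"
  shows "measure_pmf.m_dependent (mallows n q) (m - 1) N (\<lambda>j w. h (st (factor j m w)))"
  unfolding measure_pmf.m_dependent_def
proof
  fix a
  define c where "c = min a n"
  have "c \<le> n"
    by (simp add: c_def)
  with assms(1) show "prob_space.indep_set (mallows n q)
      (sets (measure_pmf.generated_sigma (mallows n q) (\<lambda>j w. h (st (factor j m w)))
        {j. j < N \<and> j + (m - 1) < a}))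
      (sets (measure_pmf.generated_sigma (mallows n q) (\<lambda>j w. h (st (factor j m w))) {a..<N}))"
  proof (rule measure_pmf.indep_set_generated_sigma[OF indep_var_cut_mallows])
    fix j assume "j \<in> {j. j < N \<and> j + (m - 1) < a}"
    then have "j < N" "j + (m - 1) < a"
      by simp_all
    then have "j + m \<le> c"
      using assms(2,3) unfolding c_def by linarith
    then have "factor j m (take c w) = factor j m w" for w
      using factor_factor[of j m c 0 w] by (simp add: factor_def)
    then have shifted: "(\<lambda>w. h (st (factor j m w))) = (\<lambda>w. h (st (factor j m (st (take c w)))))"
      by (simp add: st_factor_st)
    show "(\<lambda>w. h (st (factor j m w))) \<in> borel_measurable
        (vimage_algebra (space (mallows n q)) (\<lambda>w. st (take c w)) (count_space UNIV))"
      unfolding shifted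
      by (rule borel_measurable_vimage_algebra_count_space[where g = "\<lambda>u. h (st (factor j m u))"])
  next
    fix j assume "j \<in> {a..<N}"
    then have "c \<le> j"
      by (auto simp: c_def)
    then have "factor (j - c) m (drop c w) = factor j m w" for w
      by (simp add: factor_def)
    then have shifted: "(\<lambda>w. h (st (factor j m w)))
        = (\<lambda>w. h (st (factor (j - c) m (st (drop c w)))))"
      by (simp add: st_factor_st)
    show "(\<lambda>w. h (st (factor j m w))) \<in> borel_measurable
        (vimage_algebra (space (mallows n q)) (\<lambda>w. st (drop c w)) (count_space UNIV))"
      unfolding shifted
      by (rule borel_measurable_vimage_algebra_count_space
          [where g = "\<lambda>u. h (st (factor (j - c) m u))"])
  qed
qed

section \<open>Moments of the number of occurrences\<close>

lemma sum_toeplitz: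
  fixes c :: "nat \<Rightarrow> real"
  shows "(\<Sum>i<N. \<Sum>j<N. c (i - j + (j - i))) = real N * c 0 + 2 * (\<Sum>k=1..N. (real N - real k) * c k)"
proof (induction N)
  case (Suc N)
  have row: "(\<Sum>i<N. c (N - i)) = (\<Sum>k=1..N. c k)"
    by (rule sum.reindex_bij_witness[of _ "\<lambda>k. N - k" "\<lambda>i. N - i"]) auto
  have "(\<Sum>i<Suc N. \<Sum>j<Suc N. c (i - j + (j - i)))
      = (\<Sum>i<N. \<Sum>j<N. c (i - j + (j - i))) + (\<Sum>i<N. c (N - i)) + (\<Sum>j<N. c (N - j)) + c 0"
    by (simp add: sum.distrib)
  also have "\<dots> = real N * c 0 + 2 * (\<Sum>k=1..N. (real N - real k) * c k) + 2 * (\<Sum>k=1..N. c k) + c 0"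
    unfolding Suc.IH row by simp
  also have "\<dots> = real (Suc N) * c 0 + 2 * (\<Sum>k=1..N. (real N - real k) * c k + c k)"
    by (simp add: sum.distrib distrib_left distrib_right)
  also have "(\<Sum>k=1..N. (real N - real k) * c k + c k)
      = (\<Sum>k=1..Suc N. (real (Suc N) - real k) * c k)"
    by (simp add: algebra_simps)
  finally show ?case .
qed simp

lemma ex_Sym_avoiding:
  assumes "\<sigma> \<in> Sym m" "m \<ge> 2"
  shows "\<exists>w\<in>Sym n. \<forall>j. j + m \<le> n \<longrightarrow> st (factor j m w) \<noteq> \<sigma>"
proof -
  have ascent_iff: "\<sigma> ! 0 < \<sigma> ! 1 \<longleftrightarrow> w ! j < w ! Suc j"
    if "j + m \<le> n" "length w = n" "st (factor j m w) = \<sigma>" for w j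
    using st_order_iso[of 0 "factor j m w" 1] that assms(2) by (simp add: factor_def)
  show ?thesis
  proof (cases "\<sigma> ! 0 < \<sigma> ! 1")
    case True
    have "rev [1..<Suc n] \<in> Sym n"
      by (auto simp: permutations_of_set_def simp del: upt_Suc)
    moreover have "st (factor j m (rev [1..<Suc n])) \<noteq> \<sigma>" if "j + m \<le> n" for j
      using ascent_iff[of j "rev [1..<Suc n]"] True that assms(2)
      by (auto simp: rev_nth simp del: upt_Suc)
    ultimately show ?thesis
      by blast
  next
    case False
    have "[1..<Suc n] \<in> Sym n"
      by (auto simp: permutations_of_set_def simp del: upt_Suc)
    moreover have "st (factor j m [1..<Suc n]) \<noteq> \<sigma>" if "j + m \<le> n" for j
      using ascent_iff[of j "[1..<Suc n]"] False that assms(2) by (auto simp del: upt_Suc)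
    ultimately show ?thesis
      by blast
  qed
qed

locale mallows_pattern =
  fixes m n :: nat and \<sigma> :: "nat list" and q :: real
  assumes pattern_length: "m \<ge> 2" and pattern: "\<sigma> \<in> Sym m"
    and q_pos: "q > 0" and long_enough: "n \<ge> 2 * m - 1"
begin

definition num_windows :: nat where
  "num_windows = n + 1 - m"

definition occurrence_at :: "nat \<Rightarrow> nat list set" where
  "occurrence_at j = {w. st (factor j m w) = \<sigma>}"

abbreviation prob :: "nat list set \<Rightarrow> real" where
  "prob \<equiv> measure_pmf.prob (mallows n q)"

abbreviation covariance :: "(nat list \<Rightarrow> real) \<Rightarrow> (nat list \<Rightarrow> real) \<Rightarrow> real" where
  "covariance \<equiv> measure_pmf.covariance (mallows n q)"

lemma length_pattern [simp]: "length \<sigma> = m"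
  using pattern by (rule length_Sym)

lemma less_num_windows_iff: "j < num_windows \<longleftrightarrow> j + m \<le> n"
  using pattern_length long_enough by (auto simp: num_windows_def)

lemma real_num_windows: "real num_windows = real n - real m + 1"
  using pattern_length long_enough by (simp add: num_windows_def of_nat_diff)

lemma mu_eq_pmf: "mu \<sigma> q = pmf (mallows m q) \<sigma>"
  using q_pos pattern by (simp add: pmf_mallows mu_def)

lemma mu_pos: "mu \<sigma> q > 0"
  using q_pos qfact_pos[OF q_pos] by (simp add: mu_def)

lemma mu_le_1: "mu \<sigma> q \<le> 1"
  by (simp add: mu_eq_pmf pmf_le_1)

lemma occurrences_eq:
  assumes "w \<in> Sym n"
  shows "real (occurrences \<sigma> w) = (\<Sum>i<num_windows. indicator (occurrence_at i) w)"
proof -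
  have "occurrences \<sigma> w = card {j \<in> {..<num_windows}. w \<in> occurrence_at j}"
    by (simp add: occurrences_def occurrence_at_def length_Sym[OF assms] less_num_windows_iff)
  then show ?thesis
    by (simp add: indicator_def sum.If_cases Int_def)
qed

lemma m_dependent_occurrences:
  "measure_pmf.m_dependent (mallows n q) (m - 1) num_windows (\<lambda>j. indicator (occurrence_at j))"
proof -
  have "(\<lambda>j. indicator (occurrence_at j) :: _ \<Rightarrow> real)
      = (\<lambda>j w. indicator {\<sigma>} (st (factor j m w)))"
    by (auto simp: occurrence_at_def indicator_def fun_eq_iff)
  then show ?thesis
    using m_dependent_mallows_factors[of q m num_windows n "indicator {\<sigma>}"]
      pattern_length q_pos long_enough by (simp add: num_windows_def)
qed

lemma prob_occurrence_at: "j < num_windows \<Longrightarrow> prob (occurrence_at j) = mu \<sigma> q"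
  using prob_st_factor_mallows[OF q_pos, of j m n "{\<sigma>}"]
  by (simp add: occurrence_at_def mu_eq_pmf less_num_windows_iff measure_pmf_single)

lemma prob_Ov: "measure_pmf.prob (mallows (2 * m - s) q) (Ov s \<sigma>) = T s \<sigma> q"
proof -
  have subset: "Ov s \<sigma> \<subseteq> Sym (2 * m - s)"
    by (auto simp: Ov_def)
  then have "measure_pmf.prob (mallows (2 * m - s) q) (Ov s \<sigma>)
      = (\<Sum>\<tau>\<in>Ov s \<sigma>. pmf (mallows (2 * m - s) q) \<tau>)"
    by (intro measure_measure_pmf_finite) (auto intro: finite_subset)
  also have "\<dots> = T s \<sigma> q"
    unfolding T_def using q_pos subset by (intro sum.cong) (auto simp: pmf_mallows)
  finally show ?thesis .
qed

lemma occurrence_at_Int_iff_Ov: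
  assumes "w \<in> Sym n" "i + k < num_windows" "k < m"
  shows "w \<in> occurrence_at i \<inter> occurrence_at (i + k)
    \<longleftrightarrow> st (factor i (m + k) w) \<in> Ov (m - k) \<sigma>"
proof -
  let ?u = "factor i (m + k) w"
  have "length ?u = m + k"
    using assms(2) by (simp add: length_factor length_Sym[OF assms(1)] less_num_windows_iff)
  moreover have "distinct ?u"
    using permutations_of_setD(2)[OF assms(1)] by (rule distinct_factor)
  ultimately have "st ?u \<in> Sym (m + k)"
    using st_in_Sym[of ?u] by simp
  moreover have "2 * m - (m - k) = m + k"
    using assms(3) by simp
  moreover have "factor 0 m ?u = factor i m w" "factor k m ?u = factor (i + k) m w"
    using factor_factor[of 0 m "m + k" i w] factor_factor[of k m "m + k" i w] by simp_all
  ultimately show ?thesis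
    using assms(3) by (auto simp: occurrence_at_def Ov_def Let_def st_factor_st)
qed

lemma prob_overlapping_occurrences:
  assumes "i + k < num_windows" "0 < k" "k < m"
  shows "prob (occurrence_at i \<inter> occurrence_at (i + k)) = T (m - k) \<sigma> q"
proof -
  have "prob (occurrence_at i \<inter> occurrence_at (i + k))
      = prob {w. st (factor i (m + k) w) \<in> Ov (m - k) \<sigma>}"
    using q_pos assms occurrence_at_Int_iff_Ov
    by (intro measure_prob_cong_0) (auto simp: set_mallows pmf_eq_0_set_pmf)
  also have "\<dots> = measure_pmf.prob (mallows (m + k) q) (Ov (m - k) \<sigma>)"
    using assms q_pos by (intro prob_st_factor_mallows) (simp_all add: less_num_windows_iff)
  also have "m + k = 2 * m - (m - k)"
    using assms(3) by simp
  finally show ?thesis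
    by (simp only: prob_Ov)
qed

definition occurrence_covariance :: "nat \<Rightarrow> real" where
  "occurrence_covariance k = (if k = 0 then mu \<sigma> q * (1 - mu \<sigma> q)
     else if k < m then T (m - k) \<sigma> q - (mu \<sigma> q)\<^sup>2 else 0)"

lemma covariance_occurrences:
  assumes "i + k < num_windows"
  shows "covariance (indicator (occurrence_at i)) (indicator (occurrence_at (i + k)))
    = occurrence_covariance k"
proof -
  have covariance_eq: "covariance (indicator (occurrence_at i)) (indicator (occurrence_at (i + k)))
      = prob (occurrence_at i \<inter> occurrence_at (i + k)) - (mu \<sigma> q)\<^sup>2"
    using assms by (simp add: measure_pmf.covariance_indicator prob_occurrence_at power2_eq_square)
  consider (same) "k = 0" | (overlapping) "0 < k" "k < m" | (disjoint) "m \<le> k"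
    by linarith
  then show ?thesis
  proof cases
    case same
    then show ?thesis
      using covariance_eq assms
      by (simp add: occurrence_covariance_def prob_occurrence_at power2_eq_square
          right_diff_distrib)
  next
    case overlapping
    then show ?thesis
      using assms
      by (simp add: occurrence_covariance_def covariance_eq prob_overlapping_occurrences)
  next
    case disjoint
    then show ?thesis
      using assms pattern_length
        measure_pmf.covariance_m_dependent[OF m_dependent_occurrences, of i "i + k"]
      by (simp add: occurrence_covariance_def)
  qed
qed

lemma variance_occurrences:
  "measure_pmf.variance (mallows n q) (\<lambda>w. \<Sum>i<num_windows. indicator (occurrence_at i) w)
    = b_sq n \<sigma> q"
proof -
  let ?I = "\<lambda>i. indicator (occurrence_at i) :: nat list \<Rightarrow> real"
  have covariance_eq: "covariance (?I i) (?I j) = occurrence_covariance (i - j + (j - i))"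
    if "i < num_windows" "j < num_windows" for i j
  proof (cases "i \<le> j")
    case True
    then show ?thesis
      using covariance_occurrences[of i "j - i"] that by (simp add: occurrence_covariance_def)
  next
    case False
    then show ?thesis
      using covariance_occurrences[of j "i - j"] that
      by (simp add: occurrence_covariance_def measure_pmf.covariance_commute[of _ "?I i"])
  qed
  have "m \<le> num_windows"
    using pattern_length long_enough by (simp add: num_windows_def)
  have "measure_pmf.variance (mallows n q) (\<lambda>w. \<Sum>i<num_windows. ?I i w)
      = (\<Sum>i<num_windows. \<Sum>j<num_windows. covariance (?I i) (?I j))"
    by (intro measure_pmf.variance_sum) simp_all
  also have "\<dots> = (\<Sum>i<num_windows. \<Sum>j<num_windows. occurrence_covariance (i - j + (j - i)))"
    by (intro sum.cong refl covariance_eq) auto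
  also have "\<dots> = real num_windows * occurrence_covariance 0
      + 2 * (\<Sum>k=1..num_windows. (real num_windows - real k) * occurrence_covariance k)"
    by (rule sum_toeplitz)
  also have "(\<Sum>k=1..num_windows. (real num_windows - real k) * occurrence_covariance k)
      = (\<Sum>k=1..m - 1. (real num_windows - real k) * occurrence_covariance k)"
    using \<open>m \<le> num_windows\<close> pattern_length
    by (intro sum.mono_neutral_right) (auto simp: occurrence_covariance_def)
  also have "\<dots> = (\<Sum>s=1..m - 1. (real n - 2 * real m + 1 + real s) * (T s \<sigma> q - (mu \<sigma> q)\<^sup>2))"
    by (rule sum.reindex_bij_witness[of _ "\<lambda>s. m - s" "\<lambda>k. m - k"])
      (auto simp: occurrence_covariance_def real_num_windows of_nat_diff)
  finally show ?thesis
    by (simp add: b_sq_def Let_def real_num_windows occurrence_covariance_def)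
qed

lemma expectation_occurrences:
  "measure_pmf.expectation (mallows n q) (\<lambda>w. \<Sum>i<num_windows. indicator (occurrence_at i) w)
    = a_mean n \<sigma> q"
  by (simp add: Bochner_Integration.integral_sum prob_occurrence_at a_mean_def real_num_windows)

lemma a_mean_pos: "a_mean n \<sigma> q > 0"
  using mu_pos pattern_length long_enough
  by (simp add: a_mean_def real_num_windows[symmetric] num_windows_def)

lemma b_sq_pos: "b_sq n \<sigma> q > 0"
proof -
  let ?S = "\<lambda>w. \<Sum>i<num_windows. indicator (occurrence_at i) w :: real"
  obtain w where w: "w \<in> Sym n" "\<forall>j. j + m \<le> n \<longrightarrow> st (factor j m w) \<noteq> \<sigma>"
    using ex_Sym_avoiding[OF pattern pattern_length] by blast
  then have "?S w = 0"
    by (simp add: occurrence_at_def less_num_windows_iff)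
  have "b_sq n \<sigma> q = measure_pmf.expectation (mallows n q) (\<lambda>v. (?S v - a_mean n \<sigma> q)\<^sup>2)"
    using variance_occurrences by (simp only: expectation_occurrences)
  also have "\<dots> \<noteq> 0"
  proof
    assume "measure_pmf.expectation (mallows n q) (\<lambda>v. (?S v - a_mean n \<sigma> q)\<^sup>2) = 0"
    then have "AE v in mallows n q. (?S v - a_mean n \<sigma> q)\<^sup>2 = 0"
      using q_pos by (subst (asm) integral_nonneg_eq_0_iff_AE)
        (auto simp: set_mallows intro!: integrable_measure_pmf_finite)
    then have "(?S w - a_mean n \<sigma> q)\<^sup>2 = 0"
      using w(1) q_pos by (simp add: AE_measure_pmf_iff set_mallows)
    then show False
      using \<open>?S w = 0\<close> a_mean_pos by simp
  qed
  finally show ?thesis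
    using variance_occurrences measure_pmf.variance_positive[of "mallows n q" ?S]
    by (simp add: order.strict_iff_order)
qed

lemma b_dev_pos: "b_dev n \<sigma> q > 0"
  using b_sq_pos by (simp add: b_dev_def)

lemma theta_lower_bound: "mu \<sigma> q * (1 - mu \<sigma> q) / b_dev n \<sigma> q ^ 3 \<le> 2 * theta n \<sigma> q"
proof -
  let ?\<mu> = "mu \<sigma> q"
  have "0 \<le> (1 - 2 * ?\<mu>)\<^sup>2"
    by simp
  then have "1 \<le> 2 * ((1 - ?\<mu>)\<^sup>2 + ?\<mu>\<^sup>2)"
    by (simp add: power2_eq_square algebra_simps)
  then have "(?\<mu> * (1 - ?\<mu>)) * 1 \<le> (?\<mu> * (1 - ?\<mu>)) * (2 * ((1 - ?\<mu>)\<^sup>2 + ?\<mu>\<^sup>2))"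
    using mu_pos mu_le_1 by (intro mult_left_mono) auto
  also have "\<dots> = 2 * (?\<mu> * (1 - ?\<mu>) ^ 3 + (1 - ?\<mu>) * ?\<mu> ^ 3)"
    by (simp add: power2_eq_square power3_eq_cube algebra_simps)
  finally show ?thesis
    using b_dev_pos by (simp add: theta_def divide_right_mono)
qed

lemma theta_nonneg: "theta n \<sigma> q \<ge> 0"
  using mu_pos mu_le_1 b_dev_pos by (simp add: theta_def)

lemma prob_occurrences_eq:
  "prob {\<pi>. real (occurrences \<sigma> \<pi>) \<le> k}
    = prob {\<pi>. (\<Sum>i<num_windows. indicator (occurrence_at i) \<pi>) \<le> k}"
  using q_pos by (intro measure_prob_cong_0)
    (auto simp: set_mallows pmf_eq_0_set_pmf occurrences_eq)

lemma berry_esseen_occurrences: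
  "\<bar>prob {\<pi>. real (occurrences \<sigma> \<pi>) \<le> k}
     - cdf std_normal_distribution ((k - a_mean n \<sigma> q) / b_dev n \<sigma> q)\<bar>
   \<le> 28 * ((2 * real (m - 1) + 1)\<^sup>2 * (real num_windows * (mu \<sigma> q * (1 - mu \<sigma> q)))
       / b_dev n \<sigma> q ^ 3)"
proof -
  let ?I = "\<lambda>i. indicator (occurrence_at i) :: nat list \<Rightarrow> real"
  have mean: "(\<Sum>i<num_windows. measure_pmf.expectation (mallows n q) (?I i)) = a_mean n \<sigma> q"
    using expectation_occurrences by simp
  have variances: "(\<Sum>i<num_windows. measure_pmf.variance (mallows n q) (?I i))
      = real num_windows * (mu \<sigma> q * (1 - mu \<sigma> q))"
    using covariance_occurrences[of _ 0]
    by (simp add: measure_pmf.covariance_self occurrence_covariance_def)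
  have "\<bar>measure_pmf.prob (mallows n q) {\<pi> \<in> space (mallows n q). (\<Sum>i<num_windows. ?I i \<pi>) \<le> k}
      - cdf std_normal_distribution
          ((k - (\<Sum>i<num_windows. measure_pmf.expectation (mallows n q) (?I i))) / b_dev n \<sigma> q)\<bar>
    \<le> 28 * ((2 * real (m - 1) + 1)\<^sup>2 * 1
        * (\<Sum>i<num_windows. measure_pmf.variance (mallows n q) (?I i))
        / b_dev n \<sigma> q ^ 3)"
  proof (rule measure_pmf.m_dependent_berry_esseen[OF m_dependent_occurrences])
    show "\<bar>?I i w - measure_pmf.expectation (mallows n q) (?I i)\<bar> \<le> 1" if "i < num_windows" for i w
      using prob_occurrence_at[OF that] mu_pos mu_le_1 by (simp add: indicator_def)
    show "measure_pmf.variance (mallows n q) (\<lambda>w. \<Sum>i<num_windows. ?I i w) = (b_dev n \<sigma> q)\<^sup>2"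
      unfolding variance_occurrences using b_sq_pos by (simp add: b_dev_def)
  qed (rule b_dev_pos)
  then show ?thesis
    unfolding mean variances prob_occurrences_eq by simp
qed

end

theorem theorem8p1:
  fixes m n :: nat and \<sigma> :: "nat list" and q :: real
  assumes "m \<ge> 3" and "\<sigma> \<in> Sym m" and "q > 0" and "n \<ge> 2 * m - 1"
  shows "(SUP k::real.
            \<bar>measure_pmf.prob (mallows n q) {\<pi>. real (occurrences \<sigma> \<pi>) \<le> k}
             - cdf std_normal_distribution ((k - a_mean n \<sigma> q) / b_dev n \<sigma> q)\<bar>)
         \<le> 75 * (10 * (real m - 1) + 1)\<^sup>2 * (real n - real m + 1) * theta n \<sigma> q"
proof (rule cSUP_least)
  interpret mallows_pattern m n \<sigma> q
    using assms by unfold_locales auto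
  let ?\<theta> = "theta n \<sigma> q" and ?D = "2 * real (m - 1) + 1" and ?C = "10 * (real m - 1) + 1"
  fix k :: real
  have "\<bar>prob {\<pi>. real (occurrences \<sigma> \<pi>) \<le> k}
      - cdf std_normal_distribution ((k - a_mean n \<sigma> q) / b_dev n \<sigma> q)\<bar>
    \<le> 28 * ?D\<^sup>2 * real num_windows * (mu \<sigma> q * (1 - mu \<sigma> q) / b_dev n \<sigma> q ^ 3)"
    using berry_esseen_occurrences by (simp add: mult.assoc)
  also have "\<dots> \<le> 28 * ?D\<^sup>2 * real num_windows * (2 * ?\<theta>)"
    by (intro mult_left_mono theta_lower_bound) simp
  also have "\<dots> = 56 * ?D\<^sup>2 * (real num_windows * ?\<theta>)"
    by simp
  also have "\<dots> \<le> 75 * ?C\<^sup>2 * (real num_windows * ?\<theta>)"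
    using \<open>m \<ge> 3\<close> theta_nonneg
    by (intro mult_right_mono mult_mono power_mono) (auto simp: of_nat_diff)
  finally show "\<bar>prob {\<pi>. real (occurrences \<sigma> \<pi>) \<le> k}
      - cdf std_normal_distribution ((k - a_mean n \<sigma> q) / b_dev n \<sigma> q)\<bar>
    \<le> 75 * ?C\<^sup>2 * (real n - real m + 1) * ?\<theta>"
    by (simp add: real_num_windows mult.assoc)
qed simp

end
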